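(* Let $p>1$, $s\in(0,1)$, $m>p-1$, and let $\Omega\subset\mathbb{R}^N$ be a bounded domain with $C^{1,1}$ boundary. Let $g=g(x,t)$ be differentiable and nondecreasing in $t$ for a.e. $x\in\Omega$, and assume that for some constant $C_0>0$ $$0\le g(x,t)\le C_0(1+t)^m\quad\text{for all }t\ge0\text{ and a.e. }x\in\Omega,$$ and $$\liminf_{t\to\infty}\frac{g_t(x,t)\,t}{g(x,t)}\ge m\quad\text{uniformly for a.e. }x\in\Omega.$$ Then there exists $C$ depending only on $s,m,p,\Omega$ and $g$ such that if $u\in W_0^{s,p}(\Omega)$ is a non-negative stable solution of $$(-\Delta)_p^su=g(x,u)\ \text{in }\Omega,\qquad u=0\ \text{in }\mathbb{R}^N\setminus\Omega,$$ then $\|u\|_{W_0^{s,p}(\Omega)}\le C$. If in addition $N<G_s(m,p)$, where $$G_s(m,p):=\frac{sp}{p-1}\left(1+\frac{mp}{m-p+1}+2\sqrt{\frac{m}{m-p+1}}\right),$$ then $\|u\|_\infty\le C$.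
   Context: Function space: $[u]_{s,p}=\left(\int_{\mathbb{R}^{2N}}\frac{|u(x)-u(y)|^p}{|x-y|^{N+sp}}\,dx\,dy\right)^{1/p}$, $W^{s,p}(\mathbb{R}^N)=\{u\in L^p(\mathbb{R}^N):[u]_{s,p}<\infty\}$, and $W_0^{s,p}(\Omega)=\{u\in W^{s,p}(\mathbb{R}^N): u=0 \text{ a.e. in }\mathbb{R}^N\setminus\Omega\}$ with norm $\|u\|_{W_0^{s,p}(\Omega)}=[u]_{s,p}$; $W_0^{s,p}(\Omega)^*$ is its dual. Operator: for $u,v\in W_0^{s,p}(\Omega)$, $\langle(-\Delta)_p^s u,v\rangle=\int_{\mathbb{R}^{2N}}\frac{J_u(x,y)(v(x)-v(y))}{|x-y|^{N+sp}}\,dx\,dy$ with $J_u(x,y)=|u(x)-u(y)|^{p-2}(u(x)-u(y))$ (read as $0$ when $u(x)=u(y)$). Weak solution: $u\in W_0^{s,p}(\Omega)$ is a (weak) solution of $(-\Delta)_p^su=g(x,u)$ in $\Omega$, $u=0$ in $\mathbb{R}^N\setminus\Omega$, if $g(x,u)\in W_0^{s,p}(\Omega)^*$ (i.e. for every $v\in W_0^{s,p}(\Omega)$, $g(x,u)v\in L^1(\Omega)$ and $|\int_\Omega g(x,u)v\,dx|\le C\|v\|_{W_0^{s,p}(\Omega)}$ with $C$ independent of $v$) and $\langle(-\Delta)_p^su,v\rangle=\int_\Omega g(x,u)v\,dx$ for all $v\in W_0^{s,p}(\Omega)$ with $v\ge0$. It is understood that $x\mapsto g(x,u(x))$ is measurable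 for measurable $u$. Stability: let $\mathcal{T}_u(\Omega)=W_0^{s,p}(\Omega)$ if $p\ge2$, and, if $1<p<2$, $\mathcal{T}_u(\Omega)=\{\varphi\in W_0^{s,p}(\Omega): |\varphi(x)-\varphi(y)|\le C_\varphi|u(x)-u(y)|\text{ a.e. for some }C_\varphi>0\}$. A weak solution $u$ is stable if for all $\varphi\in\mathcal{T}_u(\Omega)$ $$(p-1)\int_{\mathbb{R}^{2N}}\frac{|u(x)-u(y)|^{p-2}(\varphi(x)-\varphi(y))^2}{|x-y|^{N+ps}}\,dx\,dy-\int_\Omega g_t(x,u)\varphi^2\,dx\ge0,$$ where $g_t=\partial g/\partial t$, for $1<p<2$ the first integrand is read as $0$ where $u(x)=u(y)$, and the second integral takes values in $[0,\infty]$. The uniform $\liminf$ condition means: for every $\overline m<m$ there is $A\ge0$, independent of $x$, such that $g_t(x,t)t\ge\overline m\,g(x,t)$ for all $t\ge A$ and a.e. $x\in\Omega$. *)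

theory Defs
  imports "HOL-Analysis.Analysis" "HOL-Probability.Essential_Supremum"
begin

text \<open>The ambient space \<open>\<real>\<^sup>N\<close> is an arbitrary type \<open>'a::euclidean_space\<close>, with \<open>N = DIM('a)\<close>.
  Integrals over \<open>\<real>\<^sup>2\<^sup>N\<close> are taken against Lebesgue measure on \<open>'a \<times> 'a\<close>.  On the diagonal
  all the singular integrands below are \<open>0\<close>, because \<open>0 / 0 = 0\<close>.\<close>

text \<open>Near each boundary point, \<open>\<Omega>\<close> is the strict epigraph, in the direction of a unit vector \<open>\<nu>\<close>,
  of a function of the coordinates orthogonal to \<open>\<nu>\<close> whose gradient is Lipschitz.  The function
  \<open>\<gamma>\<close> is taken on the whole space, but only its values on the hyperplane orthogonal to \<open>\<nu>\<close> are used;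
  any \<open>C\<^sup>1\<^sup>,\<^sup>1\<close> function on this hyperplane extends by making it constant in the direction \<open>\<nu>\<close>.\<close>

definition C11_boundary :: "'a::euclidean_space set \<Rightarrow> bool" where
  "C11_boundary \<Omega> \<longleftrightarrow>
     (\<forall>x0\<in>frontier \<Omega>. \<exists>r>0. \<exists>(\<nu>::'a) (\<gamma>::'a \<Rightarrow> real) (D::'a \<Rightarrow> 'a) (L::real).
        norm \<nu> = 1 \<and>
        (\<forall>y. GDERIV \<gamma> y :> D y) \<and> L-lipschitz_on UNIV D \<and>
        \<Omega> \<inter> ball x0 r = {x \<in> ball x0 r. \<gamma> (x - (x \<bullet> \<nu>) *\<^sub>R \<nu>) < x \<bullet> \<nu>})"

definition bounded_C11_domain :: "'a::euclidean_space set \<Rightarrow> bool" where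
  "bounded_C11_domain \<Omega> \<longleftrightarrow>
     open \<Omega> \<and> connected \<Omega> \<and> \<Omega> \<noteq> {} \<and> bounded \<Omega> \<and> C11_boundary \<Omega>"

definition gagliardo_denom :: "real \<Rightarrow> real \<Rightarrow> 'a::euclidean_space \<Rightarrow> 'a \<Rightarrow> real" where
  "gagliardo_denom s p x y = norm (x - y) powr (real DIM('a) + s * p)"

definition gagliardo_integrand ::
    "real \<Rightarrow> real \<Rightarrow> ('a::euclidean_space \<Rightarrow> real) \<Rightarrow> 'a \<times> 'a \<Rightarrow> real" where
  "gagliardo_integrand s p u = (\<lambda>(x, y). \<bar>u x - u y\<bar> powr p / gagliardo_denom s p x y)"

definition gagliardo_seminorm ::
    "real \<Rightarrow> real \<Rightarrow> ('a::euclidean_space \<Rightarrow> real) \<Rightarrow> real" where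
  "gagliardo_seminorm s p u = (LINT z|lebesgue. gagliardo_integrand s p u z) powr (1 / p)"

text \<open>Elements of the function spaces are represented by functions rather than by classes of
  functions that agree almost everywhere.\<close>

definition Wsp :: "real \<Rightarrow> real \<Rightarrow> ('a::euclidean_space \<Rightarrow> real) set" where
  "Wsp s p =
     {u \<in> borel_measurable lebesgue.
        integrable lebesgue (\<lambda>x. \<bar>u x\<bar> powr p) \<and>
        integrable lebesgue (gagliardo_integrand s p u)}"

definition W0sp :: "real \<Rightarrow> real \<Rightarrow> 'a::euclidean_space set \<Rightarrow> ('a \<Rightarrow> real) set" where
  "W0sp s p \<Omega> = {u \<in> Wsp s p. AE x in lebesgue. x \<notin> \<Omega> \<longrightarrow> u x = 0}"

definition J :: "real \<Rightarrow> ('a \<Rightarrow> real) \<Rightarrow> 'a \<Rightarrow> 'a \<Rightarrow> real" where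
  "J p u x y = \<bar>u x - u y\<bar> powr (p - 2) * (u x - u y)"

definition frac_p_laplacian ::
    "real \<Rightarrow> real \<Rightarrow> ('a::euclidean_space \<Rightarrow> real) \<Rightarrow> ('a \<Rightarrow> real) \<Rightarrow> real" where
  "frac_p_laplacian s p u v = (LINT (x, y)|lebesgue. J p u x y * (v x - v y) / gagliardo_denom s p x y)"

definition in_W0sp_dual ::
    "real \<Rightarrow> real \<Rightarrow> 'a::euclidean_space set \<Rightarrow> ('a \<Rightarrow> real) \<Rightarrow> bool" where
  "in_W0sp_dual s p \<Omega> f \<longleftrightarrow>
     (\<forall>v\<in>W0sp s p \<Omega>. set_integrable lebesgue \<Omega> (\<lambda>x. f x * v x)) \<and>
     (\<exists>C. \<forall>v\<in>W0sp s p \<Omega>. \<bar>LINT x:\<Omega>|lebesgue. f x * v x\<bar> \<le> C * gagliardo_seminorm s p v)"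

definition weak_solution ::
    "real \<Rightarrow> real \<Rightarrow> 'a::euclidean_space set \<Rightarrow> ('a \<Rightarrow> real \<Rightarrow> real) \<Rightarrow> ('a \<Rightarrow> real) \<Rightarrow> bool" where
  "weak_solution s p \<Omega> g u \<longleftrightarrow>
     u \<in> W0sp s p \<Omega> \<and>
     in_W0sp_dual s p \<Omega> (\<lambda>x. g x (u x)) \<and>
     (\<forall>v\<in>W0sp s p \<Omega>. (AE x in lebesgue. 0 \<le> v x) \<longrightarrow>
        frac_p_laplacian s p u v = (LINT x:\<Omega>|lebesgue. g x (u x) * v x))"

definition test_space ::
    "real \<Rightarrow> real \<Rightarrow> 'a::euclidean_space set \<Rightarrow> ('a \<Rightarrow> real) \<Rightarrow> ('a \<Rightarrow> real) set" where
  "test_space s p \<Omega> u =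
     (if p \<ge> 2 then W0sp s p \<Omega>
      else {\<phi> \<in> W0sp s p \<Omega>.
              \<exists>C>0. AE (x, y) in lebesgue. \<bar>\<phi> x - \<phi> y\<bar> \<le> C * \<bar>u x - u y\<bar>})"

text \<open>The power \<open>\<bar>d\<bar>\<^sup>p\<^sup>-\<^sup>2\<close>.  For \<open>p = 2\<close> it must be \<open>1\<close> also at \<open>d = 0\<close>, whereas
  \<open>0 powr 0 = 0\<close>; for \<open>p < 2\<close> the value \<open>0\<close> at \<open>d = 0\<close> is the intended convention.\<close>

definition stability_weight :: "real \<Rightarrow> real \<Rightarrow> real" where
  "stability_weight p d = (if p = 2 then 1 else \<bar>d\<bar> powr (p - 2))"

text \<open>Both integrals are \<open>[0,\<infinity>]\<close>-valued; the first is finite for \<open>\<phi>\<close> in the test space.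
  The notion is meant for \<open>g\<close> nondecreasing in \<open>t\<close>, so that no negative part is cut
  off by \<^const>\<open>ennreal\<close> in the second.\<close>

definition stable_solution ::
    "real \<Rightarrow> real \<Rightarrow> 'a::euclidean_space set \<Rightarrow> ('a \<Rightarrow> real \<Rightarrow> real) \<Rightarrow> ('a \<Rightarrow> real) \<Rightarrow> bool" where
  "stable_solution s p \<Omega> g u \<longleftrightarrow>
     weak_solution s p \<Omega> g u \<and>
     (\<forall>\<phi>\<in>test_space s p \<Omega> u.
        0 \<le> ereal (p - 1) *
              enn2ereal (\<integral>\<^sup>+(x, y). ennreal (stability_weight p (u x - u y) * (\<phi> x - \<phi> y)\<^sup>2
                                             / gagliardo_denom s p x y) \<partial>lebesgue)
            - enn2ereal (\<integral>\<^sup>+x\<in>\<Omega>. ennreal (deriv (g x) (u x) * (\<phi> x)\<^sup>2) \<partial>lebesgue))"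

definition Linf_norm :: "'a::euclidean_space set \<Rightarrow> ('a \<Rightarrow> real) \<Rightarrow> ereal" where
  "Linf_norm \<Omega> u = esssup (lebesgue_on \<Omega>) (\<lambda>x. ereal \<bar>u x\<bar>)"

definition G_crit :: "real \<Rightarrow> real \<Rightarrow> real \<Rightarrow> real" where
  "G_crit s m p = s * p / (p - 1) *
     (1 + m * p / (m - p + 1) + 2 * sqrt (m / (m - p + 1)))"

end

theory Submission
  imports Defs
begin

text \<open>
  Testing stability with \<open>\<eta> \<circ> u\<close> and the equation with \<open>H \<circ> u\<close>, where \<open>H' = \<eta>'\<^sup>2\<close>, gives
  \<open>\<integral> g\<^sub>t(x,u) \<eta>(u)\<^sup>2 \<le> (p - 1) \<integral> g(x,u) H(u)\<close>.  Take \<open>\<eta>(t) = t\<^sup>\<alpha>\<close> up to a level \<open>k\<close>, continued by its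
  tangent.  As \<open>g\<^sub>t t \<ge> m' g\<close> for large \<open>t\<close>, the right-hand side is absorbed as soon as
  \<open>(p - 1) \<alpha>\<^sup>2 < m (2\<alpha> - 1)\<close>.  The case \<open>\<alpha> = 1\<close> is the energy bound; larger \<open>\<alpha>\<close> give
  \<open>\<integral>\<^bsub>{u>k}\<^esub> g(x,u) = O(k\<^sup>-\<^sup>(\<^sup>2\<^sup>\<alpha>\<^sup>-\<^sup>1\<^sup>))\<close>.

  No Sobolev embedding is needed for the supremum bound.  Testing the equation with
  \<open>(min(u,h) - k)\<^sup>+\<close> and keeping, in the Gagliardo seminorm, only the interaction of \<open>{u > h}\<close> with the
  part of \<open>{u \<le> k}\<close> in a ball of volume \<open>2|{u > k}|\<close> yields
  \<open>(h - k)\<^sup>p\<^sup>-\<^sup>1 |{u > h}| \<le> C |{u > k}|\<^sup>s\<^sup>p\<^sup>/\<^sup>N \<integral>\<^bsub>{u>k}\<^esub> g(x,u)\<close>.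
  If \<open>|{u > k}| = O(k\<^sup>-\<^sup>\<kappa>)\<close>, this improves \<open>\<kappa>\<close> by a fixed positive amount, provided that
  \<open>N (m - p + 1) < s p (m + 2\<alpha> - 1)\<close>; an admissible \<open>\<alpha>\<close> with this property exists exactly when
  \<open>N < G\<^sub>s(m,p)\<close>.  So all powers are reached, and Stampacchia's lemma finishes the proof.
\<close>

section \<open>Measurability and test functions\<close>

text \<open>Lebesgue measure on pairs completes the Borel product measure, so the exceptional set is
  first enclosed in a Borel null set \<open>N\<close>; the strips over \<open>N\<close> in either
  coordinate are then null.\<close>

lemma AE_lebesgue_product:
  fixes P :: "'a::euclidean_space \<Rightarrow> bool"
  assumes "AE x in lebesgue. P x"
  shows "AE z in (lebesgue :: ('a \<times> 'a) measure). P (fst z) \<and> P (snd z)"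
proof -
  obtain N where N: "{x. \<not> P x} \<subseteq> N" "N \<in> null_sets (lborel :: 'a measure)"
    using assms unfolding AE_completion_iff by (auto elim!: AE_E2 AE_E simp: null_sets_def)
  then have meas: "N \<in> sets (borel :: 'a measure)" and zero: "emeasure lborel N = 0"
    by (auto simp: null_sets_def)
  have "emeasure (lborel \<Otimes>\<^sub>M lborel) (N \<times> UNIV) = 0" "emeasure (lborel \<Otimes>\<^sub>M lborel) (UNIV \<times> N) = 0"
    using meas zero by (simp_all add: lborel.emeasure_pair_measure_Times)
  moreover have "N \<times> UNIV \<in> sets (lborel \<Otimes>\<^sub>M lborel)" "UNIV \<times> N \<in> sets (lborel \<Otimes>\<^sub>M lborel)"
    using meas by auto
  ultimately have "N \<times> UNIV \<union> UNIV \<times> N \<in> null_sets (lborel :: ('a \<times> 'a) measure)"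
    unfolding lborel_prod by (intro null_sets.Un) (simp_all add: null_sets_def)
  then have "AE z in (lborel :: ('a \<times> 'a) measure). P (fst z) \<and> P (snd z)"
    by (rule AE_I') (use N in auto)
  then show ?thesis
    by (rule AE_completion)
qed

text \<open>To stay within Borel products, \<open>u\<close> is exchanged for a Borel function equal
  to it almost everywhere; the strips over the exceptional set are null.\<close>

lemma borel_measurable_lebesgue_product:
  fixes u :: "'a::euclidean_space \<Rightarrow> real"
  assumes "u \<in> borel_measurable lebesgue"
  shows "(\<lambda>z. u (fst z)) \<in> borel_measurable (lebesgue :: ('a \<times> 'a) measure)"
    and "(\<lambda>z. u (snd z)) \<in> borel_measurable (lebesgue :: ('a \<times> 'a) measure)"
proof -
  obtain u' where u': "u' \<in> borel_measurable (lborel :: 'a measure)" "AE x in lborel. u x = u' x"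
    using completion_ex_borel_measurable_real[OF assms] by blast
  have ae: "AE z in (lebesgue :: ('a \<times> 'a) measure). u (fst z) = u' (fst z) \<and> u (snd z) = u' (snd z)"
    using u'(2) by (intro AE_lebesgue_product AE_completion)
  have m: "u' \<in> borel_measurable (borel :: 'a measure)" using u'(1) by simp
  have "(\<lambda>z. u' (fst z)) \<in> borel_measurable (lborel :: ('a \<times> 'a) measure)"
    "(\<lambda>z. u' (snd z)) \<in> borel_measurable (lborel :: ('a \<times> 'a) measure)"
    using measurable_compose[OF borel_measurable_continuous_onI m, of fst]
     measurable_compose[OF borel_measurable_continuous_onI m, of snd]
    by (simp_all add: continuous_on_fst continuous_on_snd)
  from this have *: "(\<lambda>z. u' (fst z)) \<in> borel_measurable (lebesgue :: ('a \<times> 'a) measure)"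
    "(\<lambda>z. u' (snd z)) \<in> borel_measurable (lebesgue :: ('a \<times> 'a) measure)"
    by (auto intro: measurable_completion)
  show "(\<lambda>z. u (fst z)) \<in> borel_measurable (lebesgue :: ('a \<times> 'a) measure)"
    by (rule borel_measurable_AE[OF *(1)]) (use ae in eventually_elim, simp)
  show "(\<lambda>z. u (snd z)) \<in> borel_measurable (lebesgue :: ('a \<times> 'a) measure)"
    by (rule borel_measurable_AE[OF *(2)]) (use ae in eventually_elim, simp)
qed


lemma borel_measurable_gagliardo_denom:
  "(\<lambda>z. gagliardo_denom s p (fst z) (snd z))
     \<in> borel_measurable (lebesgue :: ('a::euclidean_space \<times> 'a) measure)"
proof -
  have "(\<lambda>z. norm (fst z - snd z)) \<in> borel_measurable (lborel :: ('a \<times> 'a) measure)"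
    by (simp, intro borel_measurable_continuous_onI continuous_intros)
  then have [measurable]:
    "(\<lambda>z. norm (fst z - snd z)) \<in> borel_measurable (lebesgue :: ('a \<times> 'a) measure)"
    by (rule measurable_completion)
  show ?thesis
    unfolding gagliardo_denom_def by measurable
qed

lemma gagliardo_denom_nonneg [simp]: "0 \<le> gagliardo_denom s p x y"
  by (simp add: gagliardo_denom_def)

lemma borel_measurable_weighted_difference:
  fixes u v :: "'a::euclidean_space \<Rightarrow> real" and f :: "real \<Rightarrow> real \<Rightarrow> real"
  assumes u: "u \<in> borel_measurable lebesgue" and v: "v \<in> borel_measurable lebesgue"
    and f: "(\<lambda>w. f (fst w) (snd w)) \<in> borel_measurable (borel \<Otimes>\<^sub>M borel)"
  shows "(\<lambda>(x, y). f (u x - u y) (v x - v y) / gagliardo_denom s p x y) \<in> borel_measurable lebesgue"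
proof -
  note [measurable] = borel_measurable_lebesgue_product[OF u] borel_measurable_lebesgue_product[OF v]
    borel_measurable_gagliardo_denom
  have "(\<lambda>z. (u (fst z) - u (snd z), v (fst z) - v (snd z))) \<in> lebesgue \<rightarrow>\<^sub>M borel \<Otimes>\<^sub>M borel"
    by measurable
  from measurable_compose[OF this f]
  have [measurable]: "(\<lambda>z. f (u (fst z) - u (snd z)) (v (fst z) - v (snd z))) \<in> borel_measurable lebesgue"
    by simp
  show ?thesis
    unfolding split_beta by measurable
qed

text \<open>Turns the operator tested with \<open>u\<close> itself into the seminorm. At
  \<open>d = 0\<close> both sides vanish, because \<open>0 powr r = 0\<close> for every
  exponent.\<close>

lemma abs_powr_mult_self: "\<bar>d\<bar> powr (p - 2) * d * d = \<bar>d\<bar> powr p" for d p :: real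
proof (cases "d = 0")
  case False
  have "\<bar>d\<bar> powr (p - 2) * d * d = \<bar>d\<bar> powr (p - 2) * \<bar>d\<bar> powr 2"
    using False by (simp add: power2_eq_square mult.assoc)
  then show ?thesis
    using powr_add[of "\<bar>d\<bar>" "p - 2" 2] by (simp add: power2_eq_square)
qed simp

text \<open>Values and differences grow at most by the factor \<open>L\<close>, so both integrands
  are at most \<open>L powr p\<close> times those of \<open>u\<close>; \<open>f 0 = 0\<close>
  preserves the exterior condition.\<close>

lemma W0sp_compose_lipschitz:
  assumes p: "p > 1" and u: "u \<in> W0sp s p \<Omega>" and f: "L-lipschitz_on UNIV f" and f0: "f 0 = 0"
  shows "(\<lambda>x. f (u x)) \<in> W0sp s p \<Omega>"
proof -
  have L: "0 \<le> L" and lip: "\<bar>f a - f b\<bar> \<le> L * \<bar>a - b\<bar>" for a b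
    using lipschitz_on_nonneg[OF f] lipschitz_onD[OF f, of a b] by (auto simp: dist_real_def)
  have um: "u \<in> borel_measurable lebesgue" and up: "integrable lebesgue (\<lambda>x. \<bar>u x\<bar> powr p)"
    and ug: "integrable lebesgue (gagliardo_integrand s p u)"
    and uz: "AE x in lebesgue. x \<notin> \<Omega> \<longrightarrow> u x = 0"
    using u by (auto simp: W0sp_def Wsp_def)
  have "f \<in> borel_measurable borel"
    using lipschitz_on_continuous_on[OF f] by (rule borel_measurable_continuous_onI)
  then have fm: "(\<lambda>x. f (u x)) \<in> borel_measurable lebesgue"
    by (rule measurable_compose[OF um])
  have powr_lip: "\<bar>f a - f b\<bar> powr p \<le> L powr p * \<bar>a - b\<bar> powr p" for a b
    using p powr_mono2[of p "\<bar>f a - f b\<bar>" "L * \<bar>a - b\<bar>"] lip[of a b] L by (simp add: powr_mult)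
  have 1: "integrable lebesgue (\<lambda>x. \<bar>f (u x)\<bar> powr p)"
  proof (rule Bochner_Integration.integrable_bound)
    show "integrable lebesgue (\<lambda>x. L powr p * \<bar>u x\<bar> powr p)"
      using up by simp
    show "AE x in lebesgue. norm (\<bar>f (u x)\<bar> powr p) \<le> norm (L powr p * \<bar>u x\<bar> powr p)"
      using powr_lip[of _ 0] f0 by simp
  qed (use fm in measurable)
  have 2: "integrable lebesgue (gagliardo_integrand s p (\<lambda>x. f (u x)))"
  proof (rule Bochner_Integration.integrable_bound)
    show "integrable lebesgue (\<lambda>z. L powr p * gagliardo_integrand s p u z)"
      using ug by simp
    show "AE z in lebesgue. norm (gagliardo_integrand s p (\<lambda>x. f (u x)) z)
            \<le> norm (L powr p * gagliardo_integrand s p u z)"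
    proof (intro AE_I2, clarify)
      fix x y
      have "\<bar>f (u x) - f (u y)\<bar> powr p / gagliardo_denom s p x y
          \<le> L powr p * \<bar>u x - u y\<bar> powr p / gagliardo_denom s p x y"
        by (intro divide_right_mono powr_lip) simp
      then show "norm (gagliardo_integrand s p (\<lambda>x. f (u x)) (x, y))
            \<le> norm (L powr p * gagliardo_integrand s p u (x, y))"
        by (simp add: gagliardo_integrand_def)
    qed
    show "gagliardo_integrand s p (\<lambda>x. f (u x)) \<in> borel_measurable lebesgue"
      unfolding gagliardo_integrand_def
      by (rule borel_measurable_weighted_difference[OF fm fm]) measurable
  qed
  show ?thesis
    using 1 2 fm uz f0 by (auto simp: W0sp_def Wsp_def)
qed

text \<open>Since the test function is a function of \<open>u\<close>, the integrand is dominated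
  pointwise by \<open>L\<close> times the Gagliardo integrand of \<open>u\<close>.\<close>

lemma integrable_J_lipschitz:
  fixes u :: "'a::euclidean_space \<Rightarrow> real"
  assumes u: "u \<in> W0sp s p \<Omega>" and f: "L-lipschitz_on UNIV f"
  shows "integrable lebesgue (\<lambda>(x, y). J p u x y * (f (u x) - f (u y)) / gagliardo_denom s p x y)"
proof (rule Bochner_Integration.integrable_bound)
  have L: "0 \<le> L" and lip: "\<bar>f a - f b\<bar> \<le> L * \<bar>a - b\<bar>" for a b
    using lipschitz_on_nonneg[OF f] lipschitz_onD[OF f, of a b] by (auto simp: dist_real_def)
  have um: "u \<in> borel_measurable lebesgue" and ug: "integrable lebesgue (gagliardo_integrand s p u)"
    using u by (auto simp: W0sp_def Wsp_def)
  have "f \<in> borel_measurable borel"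
    using lipschitz_on_continuous_on[OF f] by (rule borel_measurable_continuous_onI)
  then have fm: "(\<lambda>x. f (u x)) \<in> borel_measurable lebesgue"
    by (rule measurable_compose[OF um])
  show "integrable lebesgue (\<lambda>z. L * gagliardo_integrand s p u z)"
    using ug by simp
  show "(\<lambda>(x, y). J p u x y * (f (u x) - f (u y)) / gagliardo_denom s p x y) \<in> borel_measurable lebesgue"
    unfolding J_def by (rule borel_measurable_weighted_difference[OF um fm]) measurable
  have "\<bar>J p u x y * (f (u x) - f (u y))\<bar> \<le> L * \<bar>u x - u y\<bar> powr p" for x y
  proof -
    have "\<bar>J p u x y * (f (u x) - f (u y))\<bar> \<le> \<bar>u x - u y\<bar> powr (p - 2) * \<bar>u x - u y\<bar> * (L * \<bar>u x - u y\<bar>)"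
      unfolding J_def abs_mult by (simp add: mult_left_mono lip)
    also have "\<dots> = L * \<bar>u x - u y\<bar> powr p"
      using abs_powr_mult_self[of "\<bar>u x - u y\<bar>" p] by (simp add: algebra_simps)
    finally show ?thesis .
  qed
  then have "\<bar>J p u x y * (f (u x) - f (u y))\<bar> / gagliardo_denom s p x y
      \<le> L * \<bar>u x - u y\<bar> powr p / gagliardo_denom s p x y" for x y
    by (intro divide_right_mono) simp_all
  then show "AE z in lebesgue.
      norm (case z of (x, y) \<Rightarrow> J p u x y * (f (u x) - f (u y)) / gagliardo_denom s p x y)
        \<le> norm (L * gagliardo_integrand s p u z)"
    using L by (intro AE_I2) (auto simp: gagliardo_integrand_def abs_mult)
qed

text \<open>The last hypothesis is the difference form of H' = (\<eta>')^2. Multiplied by |u(x) -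
  u(y)|^(p-2) it bounds the stability integrand by that of the operator tested with H(u), and the
  equation evaluates the latter.\<close>

lemma stable_solution_test_pair:
  fixes u :: "'a::euclidean_space \<Rightarrow> real"
  assumes p: "p > 1" and stable: "stable_solution s p \<Omega> g u" and pos: "AE x in lebesgue. 0 \<le> u x"
    and \<eta>: "L-lipschitz_on UNIV \<eta>" "\<eta> 0 = 0"
    and H: "M-lipschitz_on UNIV H" "H 0 = 0" "\<And>t. 0 \<le> t \<Longrightarrow> 0 \<le> H t"
    and \<eta>H: "\<And>a b. (\<eta> a - \<eta> b)\<^sup>2 \<le> (a - b) * (H a - H b)"
  shows "(\<integral>\<^sup>+x\<in>\<Omega>. ennreal (deriv (g x) (u x) * (\<eta> (u x))\<^sup>2) \<partial>lebesgue)
           \<le> ennreal ((p - 1) * (LINT x:\<Omega>|lebesgue. g x (u x) * H (u x)))"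
proof -
  have weak: "weak_solution s p \<Omega> g u"
    using stable by (simp add: stable_solution_def)
  then have u: "u \<in> W0sp s p \<Omega>"
    by (simp add: weak_solution_def)
  have L: "0 \<le> L" and lip: "\<bar>\<eta> a - \<eta> b\<bar> \<le> L * \<bar>a - b\<bar>" for a b
    using lipschitz_on_nonneg[OF \<eta>(1)] lipschitz_onD[OF \<eta>(1), of a b] by (auto simp: dist_real_def)
  \<comment> \<open>For \<open>p < 2\<close> the test space asks for a strictly positive constant,
    whereas \<open>L\<close> may be 0.\<close>
  have "\<bar>\<eta> a - \<eta> b\<bar> \<le> (L + 1) * \<bar>a - b\<bar>" for a b
    using lip[of a b] by (simp add: algebra_simps)
  then have test: "(\<lambda>x. \<eta> (u x)) \<in> test_space s p \<Omega> u"
  proof -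
    have "\<exists>C>0. AE (x, y) in lebesgue. \<bar>\<eta> (u x) - \<eta> (u y)\<bar> \<le> C * \<bar>u x - u y\<bar>" if "p < 2"
      using L \<open>\<And>a b. \<bar>\<eta> a - \<eta> b\<bar> \<le> (L + 1) * \<bar>a - b\<bar>\<close>
      by (intro exI[of _ "L + 1"] conjI AE_I2) (simp_all add: split_beta)
    then show ?thesis
      using W0sp_compose_lipschitz[OF p u \<eta>] by (simp add: test_space_def)
  qed
  define I1 where "I1 = (\<integral>\<^sup>+(x, y). ennreal (stability_weight p (u x - u y) * (\<eta> (u x) - \<eta> (u y))\<^sup>2
      / gagliardo_denom s p x y) \<partial>lebesgue)"
  define I2 where "I2 = (\<integral>\<^sup>+x\<in>\<Omega>. ennreal (deriv (g x) (u x) * (\<eta> (u x))\<^sup>2) \<partial>lebesgue)"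
  define c where "c = (LINT x:\<Omega>|lebesgue. g x (u x) * H (u x))"
  have ineq: "0 \<le> ereal (p - 1) * enn2ereal I1 - enn2ereal I2"
    using bspec[OF conjunct2[OF stable[unfolded stable_solution_def]] test]
    by (simp only: I1_def I2_def)
  \<comment> \<open>Where \<open>u x = u y\<close> both sides vanish, also for \<open>p = 2\<close>
    with weight 1.\<close>
  have le: "stability_weight p (u x - u y) * (\<eta> (u x) - \<eta> (u y))\<^sup>2
      \<le> J p u x y * (H (u x) - H (u y))" for x y
  proof (cases "u x = u y")
    case False
    then have "stability_weight p (u x - u y) = \<bar>u x - u y\<bar> powr (p - 2)"
      by (simp add: stability_weight_def)
    then show ?thesis
      unfolding J_def by (simp add: mult.assoc mult_left_mono \<eta>H)
  qed (simp add: J_def)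
  have "I1 \<le> (\<integral>\<^sup>+z. ennreal (case z of (x, y) \<Rightarrow> J p u x y * (H (u x) - H (u y))
      / gagliardo_denom s p x y) \<partial>lebesgue)"
    unfolding I1_def by (intro nn_integral_mono) (auto intro!: ennreal_leI divide_right_mono le)
  also have "\<dots> = ennreal (frac_p_laplacian s p u (\<lambda>x. H (u x)))"
    unfolding frac_p_laplacian_def
  proof (rule nn_integral_eq_integral[OF integrable_J_lipschitz[OF u H(1)]])
    have "0 \<le> J p u x y * (H (u x) - H (u y))" for x y
      by (rule order_trans[OF _ le]) (simp add: stability_weight_def)
    then show "AE z in lebesgue. 0 \<le> (case z of (x, y) \<Rightarrow>
        J p u x y * (H (u x) - H (u y)) / gagliardo_denom s p x y)"
      by auto
  qed
  also have "frac_p_laplacian s p u (\<lambda>x. H (u x)) = c"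
  proof -
    have "AE x in lebesgue. 0 \<le> H (u x)"
      using pos by eventually_elim (rule H(3))
    then show ?thesis
      using weak[unfolded weak_solution_def, THEN conjunct2, THEN conjunct2, rule_format,
          OF W0sp_compose_lipschitz[OF p u H(1,2)]]
      by (simp only: c_def)
  qed
  finally have I1: "I1 \<le> ennreal c" .
  have "I2 \<le> ennreal ((p - 1) * c)"
  proof (cases I1)
    case (real a)
    have "I2 \<noteq> top"
      using ineq real by auto
    then obtain b where b: "I2 = ennreal b" "0 \<le> b"
      by (cases I2) auto
    have "b \<le> (p - 1) * a"
      using ineq real b by simp
    show ?thesis
    \<comment> \<open>The sign of \<open>c\<close> is not known at this point and
      \<open>ennreal c\<close> is 0 for negative \<open>c\<close>, so \<open>a \<le> c\<close> can
      be inferred only from \<open>a > 0\<close>.\<close>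
    proof (cases "a = 0")
      case True
      with b \<open>b \<le> (p - 1) * a\<close> show ?thesis by simp
    next
      case False
      then have "a \<le> c"
        using I1 real by (cases "0 \<le> c") (simp_all add: ennreal_neg)
      then have "(p - 1) * a \<le> (p - 1) * c"
        using p by simp
      with \<open>b \<le> (p - 1) * a\<close> show ?thesis
        unfolding b(1) by (intro ennreal_leI) linarith
    qed
  next
    case top
    then show ?thesis using I1 by (simp add: top_unique)
  qed
  then show ?thesis
    by (simp add: I2_def c_def)
qed

section \<open>Truncated powers\<close>

text \<open>The tangent above \<open>k\<close> and the value 0 on the negative axis make the power
  Lipschitz on the whole line, as composition with \<open>u\<close> requires.\<close>

definition trunc_power :: "real \<Rightarrow> real \<Rightarrow> real \<Rightarrow> real" where
  "trunc_power \<alpha> k t = min (max t 0) k powr \<alpha> + \<alpha> * k powr (\<alpha> - 1) * max 0 (t - k)"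

text \<open>The primitive, vanishing at 0, of the squared derivative of
  \<open>trunc_power\<close>.\<close>

definition trunc_power_energy :: "real \<Rightarrow> real \<Rightarrow> real \<Rightarrow> real" where
  "trunc_power_energy \<alpha> k t =
     \<alpha>\<^sup>2 / (2 * \<alpha> - 1) * min (max t 0) k powr (2 * \<alpha> - 1) + (\<alpha> * k powr (\<alpha> - 1))\<^sup>2 * max 0 (t - k)"

lemma mono_glue:
  fixes f :: "real \<Rightarrow> real"
  assumes "\<And>x y. x \<le> y \<Longrightarrow> y \<le> c \<Longrightarrow> f x \<le> f y" "\<And>x y. c \<le> x \<Longrightarrow> x \<le> y \<Longrightarrow> f x \<le> f y"
  shows "mono f"
  using assms by (intro monoI) (meson linear order_trans order_refl)

text \<open>If \<open>e\<close> is the slope of the truncated power at a point, the combination has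
  slope a e^2 + b e + c there, and \<open>e\<close> stays between 0 and the slope of the tangent.
  Monotonicity, Lipschitz bounds and the Cauchy-Schwarz inequality all come from this by choosing
  the coefficients.\<close>

lemma mono_trunc_power_combination:
  assumes \<alpha>: "1 \<le> \<alpha>" and k: "0 < k"
    and nonneg: "\<And>e. 0 \<le> e \<Longrightarrow> e \<le> \<alpha> * k powr (\<alpha> - 1) \<Longrightarrow> 0 \<le> a * e\<^sup>2 + b * e + c"
  shows "mono (\<lambda>t. a * trunc_power_energy \<alpha> k t + b * trunc_power \<alpha> k t + c * t)" (is "mono ?F")
proof -
  define E where "E = \<alpha> * k powr (\<alpha> - 1)"
  have E: "0 \<le> E" using \<alpha> by (simp add: E_def)
  let ?P = "\<lambda>t. a * (\<alpha>\<^sup>2 / (2 * \<alpha> - 1) * t powr (2 * \<alpha> - 1)) + b * t powr \<alpha> + c * t"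
  have left: "?F x \<le> ?F y" if "x \<le> y" "y \<le> 0" for x y
    using that k nonneg[of 0] \<alpha>
    by (simp add: trunc_power_def trunc_power_energy_def min_def max_def mult_left_mono)
  have P: "?F t = ?P t" if "0 \<le> t" "t \<le> k" for t
    using that by (simp add: trunc_power_def trunc_power_energy_def)
  have mid: "?F x \<le> ?F y" if "0 \<le> x" "x \<le> y" "y \<le> k" for x y
  proof -
    have "?P x \<le> ?P y"
    \<comment> \<open>The power is differentiated only at positive points; the end points, possibly
      0, are reached by continuity.\<close>
    proof (rule DERIV_nonneg_imp_increasing_open[OF \<open>x \<le> y\<close>])
      fix t assume t: "x < t" "t < y"
      then have t0: "0 < t" using that by simp
      have "(?P has_real_derivative
          a * (\<alpha>\<^sup>2 / (2 * \<alpha> - 1) * ((2 * \<alpha> - 1) * t powr (2 * \<alpha> - 1 - 1)))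
            + b * (\<alpha> * t powr (\<alpha> - 1)) + c) (at t)"
        using t0 by (auto intro!: derivative_eq_intros)
      also have "a * (\<alpha>\<^sup>2 / (2 * \<alpha> - 1) * ((2 * \<alpha> - 1) * t powr (2 * \<alpha> - 1 - 1)))
            + b * (\<alpha> * t powr (\<alpha> - 1)) + c
          = a * (\<alpha> * t powr (\<alpha> - 1))\<^sup>2 + b * (\<alpha> * t powr (\<alpha> - 1)) + c"
      proof -
        have "t powr (2 * \<alpha> - 1 - 1) = (t powr (\<alpha> - 1))\<^sup>2"
          using t0 by (simp add: power2_eq_square flip: powr_add)
        then show ?thesis using \<alpha> by (simp add: power_mult_distrib)
      qed
      finally have d: "(?P has_real_derivative
          a * (\<alpha> * t powr (\<alpha> - 1))\<^sup>2 + b * (\<alpha> * t powr (\<alpha> - 1)) + c) (at t)" .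
      have "\<alpha> * t powr (\<alpha> - 1) \<le> \<alpha> * k powr (\<alpha> - 1)"
        using t that t0 \<alpha> by (intro mult_left_mono powr_mono2) auto
      then have "0 \<le> a * (\<alpha> * t powr (\<alpha> - 1))\<^sup>2 + b * (\<alpha> * t powr (\<alpha> - 1)) + c"
        using \<alpha> by (intro nonneg) auto
      with d show "\<exists>z. (?P has_real_derivative z) (at t) \<and> 0 \<le> z" by blast
    next
      show "continuous_on {x..y} ?P"
        using that \<alpha> by (intro continuous_intros continuous_on_powr') auto
    qed
    then show ?thesis using P that by simp
  qed
  have right: "?F x \<le> ?F y" if "k \<le> x" "x \<le> y" for x y
  proof -
    have "?F y - ?F x = (a * E\<^sup>2 + b * E + c) * (y - x)"
      using that k by (simp add: trunc_power_def trunc_power_energy_def E_def algebra_simps)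
    moreover have "0 \<le> (a * E\<^sup>2 + b * E + c) * (y - x)"
      using nonneg[of E] E that by (simp add: E_def)
    ultimately show ?thesis by linarith
  qed
  have "?F x \<le> ?F y" if "x \<le> y" "y \<le> k" for x y
  proof (cases "0 \<le> x")
    case False
    show ?thesis
      using False left[of x y] left[of x 0] mid[of 0 y] that by (cases "y \<le> 0") auto
  qed (use mid that in auto)
  then show ?thesis
    using right by (rule mono_glue)
qed

context
  fixes \<alpha> k :: real
  assumes \<alpha>: "1 \<le> \<alpha>" and k: "0 < k"
begin

lemma mono_trunc_power_energy: "mono (trunc_power_energy \<alpha> k)"
  using mono_trunc_power_combination[OF \<alpha> k, of 1 0 0] by simp

lemma trunc_power_0 [simp]: "trunc_power \<alpha> k 0 = 0" "trunc_power_energy \<alpha> k 0 = 0"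
  using \<alpha> k by (simp_all add: trunc_power_def trunc_power_energy_def)

text \<open>A monotone \<open>f\<close> is \<open>L\<close>-Lipschitz as soon as
  \<open>L * t - f t\<close> is monotone too; on slopes this means e \<le> E and e^2 \<le>
  E^2.\<close>

lemma lipschitz_trunc_power:
  "(\<alpha> * k powr (\<alpha> - 1))-lipschitz_on UNIV (trunc_power \<alpha> k)"
  "((\<alpha> * k powr (\<alpha> - 1))\<^sup>2)-lipschitz_on UNIV (trunc_power_energy \<alpha> k)"
proof -
  let ?E = "\<alpha> * k powr (\<alpha> - 1)"
  have E: "0 \<le> ?E" using \<alpha> by simp
  have *: "L-lipschitz_on UNIV f" if "0 \<le> L" "mono f" "mono (\<lambda>t. L * t - f t)" for L and f :: "real \<Rightarrow> real"
  proof (rule lipschitz_onI)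
    have "dist (f a) (f b) \<le> L * dist a b" if "a \<le> b" for a b
      using monoD[OF \<open>mono f\<close> that] monoD[OF \<open>mono (\<lambda>t. L * t - f t)\<close> that] that
      by (simp add: dist_real_def algebra_simps)
    then show "dist (f a) (f b) \<le> L * dist a b" for a b
      by (metis dist_commute linorder_le_cases)
  qed (use \<open>0 \<le> L\<close> in simp)
  show "?E-lipschitz_on UNIV (trunc_power \<alpha> k)"
    using mono_trunc_power_combination[OF \<alpha> k, of 0 1 0] mono_trunc_power_combination[OF \<alpha> k, of 0 "-1" ?E]
    by (intro * E) (simp_all add: algebra_simps)
  show "(?E\<^sup>2)-lipschitz_on UNIV (trunc_power_energy \<alpha> k)"
  proof (intro * mono_trunc_power_energy)
    have "mono (\<lambda>t. (-1) * trunc_power_energy \<alpha> k t + 0 * trunc_power \<alpha> k t + ?E\<^sup>2 * t)"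
      by (rule mono_trunc_power_combination[OF \<alpha> k]) (use power_mono in fastforce)
    then show "mono (\<lambda>t. ?E\<^sup>2 * t - trunc_power_energy \<alpha> k t)"
      by (simp add: algebra_simps)
  qed simp
qed

text \<open>The energy is a primitive of the squared derivative of the truncated power, so this is the
  Cauchy--Schwarz inequality on \<open>[b, a]\<close>, obtained from the discriminant of a nonnegative quadratic.\<close>

lemma trunc_power_diff_sq_le:
  "(trunc_power \<alpha> k a - trunc_power \<alpha> k b)\<^sup>2
     \<le> (a - b) * (trunc_power_energy \<alpha> k a - trunc_power_energy \<alpha> k b)"
proof -
  have *: "(trunc_power \<alpha> k a - trunc_power \<alpha> k b)\<^sup>2
     \<le> (a - b) * (trunc_power_energy \<alpha> k a - trunc_power_energy \<alpha> k b)" if "b < a" for a b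
  proof -
    \<comment> \<open>With the mean slope \<open>d\<close> and coefficients 1, -2d, d^2 the
      quadratic becomes (e - d)^2.\<close>
    define d where "d = (trunc_power \<alpha> k a - trunc_power \<alpha> k b) / (a - b)"
    have "mono (\<lambda>t. 1 * trunc_power_energy \<alpha> k t + (- 2 * d) * trunc_power \<alpha> k t + d\<^sup>2 * t)"
    proof (rule mono_trunc_power_combination[OF \<alpha> k])
      fix e
      have "1 * e\<^sup>2 + - 2 * d * e + d\<^sup>2 = (e - d)\<^sup>2"
        by (simp add: power2_eq_square algebra_simps)
      then show "0 \<le> 1 * e\<^sup>2 + - 2 * d * e + d\<^sup>2" by simp
    qed
    from monoD[OF this, of b a] that
    have "0 \<le> (trunc_power_energy \<alpha> k a - trunc_power_energy \<alpha> k b)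
        - 2 * d * (trunc_power \<alpha> k a - trunc_power \<alpha> k b) + d\<^sup>2 * (a - b)"
      by (simp add: algebra_simps)
    also have "trunc_power \<alpha> k a - trunc_power \<alpha> k b = d * (a - b)"
      using that by (simp add: d_def)
    finally have "d\<^sup>2 * (a - b) \<le> trunc_power_energy \<alpha> k a - trunc_power_energy \<alpha> k b"
      by (simp add: power2_eq_square algebra_simps)
    from mult_left_mono[OF this, of "a - b"] that show ?thesis
      unfolding \<open>trunc_power \<alpha> k a - trunc_power \<alpha> k b = d * (a - b)\<close>
      by (simp add: power2_eq_square algebra_simps)
  qed
  then show ?thesis
    using *[of a b] *[of b a] by (cases a b rule: linorder_cases) (auto simp: power2_commute algebra_simps)
qed

lemma trunc_power_energy_nonneg: "0 \<le> t \<Longrightarrow> 0 \<le> trunc_power_energy \<alpha> k t"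
  using monoD[OF mono_trunc_power_energy, of 0 t] by simp

lemma trunc_power_energy_below:
  "0 \<le> t \<Longrightarrow> t \<le> k \<Longrightarrow> trunc_power_energy \<alpha> k t = \<alpha>\<^sup>2 / (2 * \<alpha> - 1) * t powr (2 * \<alpha> - 1)"
  by (simp add: trunc_power_energy_def)

text \<open>Converts the weight of the stability inequality into that of the tested equation, so
  that g_t(x,t) t \<ge> m' g(x,t) can be used between them. Equality holds up to \<open>k\<close>;
  above \<open>k\<close> the defect is a nonnegative square.\<close>

lemma mult_trunc_power_energy_le:
  assumes t: "0 \<le> t"
  shows "t * trunc_power_energy \<alpha> k t \<le> \<alpha>\<^sup>2 / (2 * \<alpha> - 1) * (trunc_power \<alpha> k t)\<^sup>2"
proof -
  define c where "c = \<alpha>\<^sup>2 / (2 * \<alpha> - 1)"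
  have sq: "\<alpha>\<^sup>2 = c * (2 * \<alpha> - 1)" using \<alpha> by (simp add: c_def)
  \<comment> \<open>This is \<alpha>^2 \<ge> 2 \<alpha> - 1, that is,
    \<open>c \<ge> 1\<close>.\<close>
  have "0 \<le> (\<alpha> - 1)\<^sup>2" by simp
  then have c: "1 \<le> c" using \<alpha> by (simp add: c_def power2_eq_square algebra_simps)
  show ?thesis
  proof (cases "t \<le> k")
    case True
    have "t * t powr (2 * \<alpha> - 1) = (t powr \<alpha>)\<^sup>2"
      using t by (simp add: powr_mult_base power2_eq_square flip: powr_add)
    then show ?thesis
      using t True
      by (simp add: trunc_power_energy_def trunc_power_def mult.left_commute[of t])
  next
    case False
    define \<sigma> where "\<sigma> = t - k"
    define q where "q = k powr (\<alpha> - 1)"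
    have \<sigma>: "0 < \<sigma>" "t = k + \<sigma>" using False by (simp_all add: \<sigma>_def)
    have "k powr \<alpha> = k * q" "k powr (2 * \<alpha> - 1) = k * q * q"
      using k by (simp_all add: q_def powr_mult_base flip: powr_add)
    then have \<eta>: "trunc_power \<alpha> k t = q * (k + \<alpha> * \<sigma>)"
      and "trunc_power_energy \<alpha> k t = c * (k * q * q) + (\<alpha> * q)\<^sup>2 * \<sigma>"
      using \<sigma> k by (simp_all add: trunc_power_def trunc_power_energy_def
        flip: c_def q_def) (simp add: algebra_simps)
    then have H: "trunc_power_energy \<alpha> k t = q\<^sup>2 * (c * k + \<alpha>\<^sup>2 * \<sigma>)"
      by (simp add: power2_eq_square algebra_simps)
    \<comment> \<open>The value of \<open>c\<close> is the one that cancels the mixed term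
      \<open>k * \<sigma>\<close>.\<close>
    have "c * (k + \<alpha> * \<sigma>)\<^sup>2 - (k + \<sigma>) * (c * k + \<alpha>\<^sup>2 * \<sigma>)
        = (c - 1) * (\<alpha> * \<sigma>)\<^sup>2 + k * \<sigma> * (c * (2 * \<alpha> - 1) - \<alpha>\<^sup>2)"
      by (simp add: power2_eq_square algebra_simps)
    also have "\<dots> = (c - 1) * (\<alpha> * \<sigma>)\<^sup>2"
      by (simp only: sq) simp
    also have "0 \<le> \<dots>" using c by simp
    finally have "q\<^sup>2 * ((k + \<sigma>) * (c * k + \<alpha>\<^sup>2 * \<sigma>)) \<le> q\<^sup>2 * (c * (k + \<alpha> * \<sigma>)\<^sup>2)"
      by (intro mult_left_mono) simp_all
    then show ?thesis
      unfolding \<eta> H c_def[symmetric] by (simp add: \<sigma>(2) power_mult_distrib mult.left_commute)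
  qed
qed

end

section \<open>Energy bounds for stable solutions\<close>

text \<open>One solution is fixed; bounds whose right-hand side does not mention \<open>u\<close>
  are thereby uniform over all solutions. The lower bound on the derivative of \<open>g\<close> is
  left out because its threshold varies with the exponent used.\<close>

locale nonneg_stable_solution =
  fixes s p m C0 :: real and \<Omega> :: "'a::euclidean_space set"
    and g :: "'a \<Rightarrow> real \<Rightarrow> real" and u :: "'a \<Rightarrow> real"
  assumes p: "p > 1" and s: "0 < s" and m: "m > 0" and C0: "C0 > 0"
    and \<Omega>: "\<Omega> \<in> lmeasurable"
    and growth: "AE x\<in>\<Omega> in lebesgue. \<forall>t\<ge>0. 0 \<le> g x t \<and> g x t \<le> C0 * (1 + t) powr m"
    and stable: "stable_solution s p \<Omega> g u"
    and nonneg: "AE x in lebesgue. 0 \<le> u x"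
begin

lemma weak: "weak_solution s p \<Omega> g u"
  using stable by (simp add: stable_solution_def)

lemma u_W0sp: "u \<in> W0sp s p \<Omega>"
  using weak by (simp add: weak_solution_def)

lemma u_measurable [measurable]: "u \<in> borel_measurable lebesgue"
  using u_W0sp by (simp add: W0sp_def Wsp_def)

lemma \<Omega>_sets [measurable]: "\<Omega> \<in> sets lebesgue"
  using \<Omega> by (rule fmeasurableD)

lemma set_integrable_reaction:
  assumes f: "L-lipschitz_on UNIV f" "f 0 = 0"
  shows "set_integrable lebesgue \<Omega> (\<lambda>x. g x (u x) * f (u x))"
  using weak[unfolded weak_solution_def in_W0sp_dual_def] W0sp_compose_lipschitz[OF p u_W0sp f]
  by auto

lemma frac_p_laplacian_compose:
  assumes f: "L-lipschitz_on UNIV f" "f 0 = 0" "\<And>t. 0 \<le> t \<Longrightarrow> 0 \<le> f t"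
  shows "frac_p_laplacian s p u (\<lambda>x. f (u x)) = (LINT x:\<Omega>|lebesgue. g x (u x) * f (u x))"
proof -
  have "AE x in lebesgue. 0 \<le> f (u x)"
    using nonneg by eventually_elim (rule f(3))
  then show ?thesis
    using weak[unfolded weak_solution_def, THEN conjunct2, THEN conjunct2, rule_format,
        OF W0sp_compose_lipschitz[OF p u_W0sp f(1,2)]] by simp
qed

lemma reaction_bounds:
  "AE x\<in>\<Omega> in lebesgue. 0 \<le> u x \<and> 0 \<le> g x (u x) \<and> g x (u x) \<le> C0 * (1 + u x) powr m"
  using growth nonneg by eventually_elim auto

text \<open>The integral is split at \<open>u = A\<close>. Stability and the lower bound on the
  derivative control the part above \<open>A\<close> by (p - 1) c / m' < 1 times the whole, so it is
  absorbed; the part below \<open>A\<close> is bounded by the growth condition. The result depends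
  neither on \<open>k\<close> nor on \<open>u\<close>.\<close>

lemma reaction_energy_bound:
  assumes \<alpha>: "1 \<le> \<alpha>" and A: "0 < A" "A \<le> k"
    and m': "(p - 1) * \<alpha>\<^sup>2 < m' * (2 * \<alpha> - 1)"
    and lower: "AE x\<in>\<Omega> in lebesgue. \<forall>t\<ge>A. m' * g x t \<le> deriv (g x) t * t"
  shows "(LINT x:\<Omega>|lebesgue. g x (u x) * trunc_power_energy \<alpha> k (u x))
    \<le> m' / (m' - (p - 1) * (\<alpha>\<^sup>2 / (2 * \<alpha> - 1)))
      * (C0 * (1 + A) powr m * (\<alpha>\<^sup>2 / (2 * \<alpha> - 1) * A powr (2 * \<alpha> - 1)) * measure lebesgue \<Omega>)"
proof -
  define c where "c = \<alpha>\<^sup>2 / (2 * \<alpha> - 1)"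
  have k: "0 < k" using A by simp
  have c: "0 < c" using \<alpha> by (simp add: c_def)
  have m'c: "(p - 1) * c < m'" using m' \<alpha> by (simp add: c_def field_simps)
  then have m'0: "0 < m'" using p c by (smt (verit) mult_pos_pos)
  let ?\<eta> = "trunc_power \<alpha> k" and ?H = "trunc_power_energy \<alpha> k"
  note lip = lipschitz_trunc_power[OF \<alpha> k] and zero = trunc_power_0[OF \<alpha> k]
  define F where "F x = indicat_real \<Omega> x * (g x (u x) * ?H (u x))" for x
  have F: "integrable lebesgue F"
    using set_integrable_reaction[OF lip(2) zero(2)] by (simp add: set_integrable_def F_def[abs_def])
  have FL: "(LINT x:\<Omega>|lebesgue. g x (u x) * ?H (u x)) = (LINT x|lebesgue. F x)"
    by (simp add: set_lebesgue_integral_def F_def[abs_def])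
  define X where "X x = indicat_real {x. A \<le> u x} x * F x" for x
  define Y where "Y x = indicat_real {x. u x < A} x * F x" for x
  have "{x \<in> space lebesgue. A \<le> u x} \<in> sets lebesgue" "{x \<in> space lebesgue. u x < A} \<in> sets lebesgue"
    by measurable
  then have [measurable]: "{x. A \<le> u x} \<in> sets lebesgue" "{x. u x < A} \<in> sets lebesgue"
    by simp_all
  have X: "integrable lebesgue X" and Y: "integrable lebesgue Y"
    using integrable_mult_indicator[OF _ F, of "{x. A \<le> u x}"]
      integrable_mult_indicator[OF _ F, of "{x. u x < A}"] by (simp_all add: X_def[abs_def] Y_def[abs_def])
  have "F x = X x + Y x" for x
    by (simp add: X_def Y_def indicator_def)
  then have XY: "(LINT x|lebesgue. F x) = (LINT x|lebesgue. X x) + (LINT x|lebesgue. Y x)"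
    using X Y by simp
  have Fnn: "AE x in lebesgue. 0 \<le> F x"
    using reaction_bounds
    by eventually_elim (auto simp: F_def indicator_def trunc_power_energy_nonneg[OF \<alpha> k])
  have "ennreal ((m' / c) * (LINT x|lebesgue. X x)) = (\<integral>\<^sup>+x. ennreal ((m' / c) * X x) \<partial>lebesgue)"
  proof -
    have "AE x in lebesgue. 0 \<le> m' / c * X x"
      using Fnn by eventually_elim (use c m'0 in \<open>simp add: X_def\<close>)
    from nn_integral_eq_integral[OF integrable_mult_right[OF X] this]
    show ?thesis by simp
  qed
  also have "\<dots> \<le> (\<integral>\<^sup>+x\<in>\<Omega>. ennreal (deriv (g x) (u x) * (?\<eta> (u x))\<^sup>2) \<partial>lebesgue)"
  proof (rule nn_integral_mono_AE)
    show "AE x in lebesgue. ennreal (m' / c * X x)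
        \<le> ennreal (deriv (g x) (u x) * (?\<eta> (u x))\<^sup>2) * indicator \<Omega> x"
      using lower reaction_bounds
    proof eventually_elim
      case (elim x)
      show ?case
      proof (cases "x \<in> \<Omega> \<and> A \<le> u x")
        case True
        then have *: "m' * g x (u x) \<le> deriv (g x) (u x) * u x" and g0: "0 \<le> g x (u x)" and u: "0 < u x"
          using elim A by auto
        \<comment> \<open>The sign of the derivative is read off from g_t(x,u) u \<ge> m' g(x,u)
          \<ge> 0.\<close>
        have "0 \<le> deriv (g x) (u x) * u x"
          using * g0 m'0 by (smt (verit) mult_nonneg_nonneg)
        then have d0: "0 \<le> deriv (g x) (u x)"
          using u by (simp add: zero_le_mult_iff)
        have "m' * g x (u x) * ?H (u x) \<le> deriv (g x) (u x) * u x * ?H (u x)"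
          using * u by (intro mult_right_mono trunc_power_energy_nonneg[OF \<alpha> k]) auto
        also have "\<dots> = deriv (g x) (u x) * (u x * ?H (u x))" by simp
        also have "\<dots> \<le> deriv (g x) (u x) * (c * (?\<eta> (u x))\<^sup>2)"
          unfolding c_def using u d0 by (intro mult_left_mono mult_trunc_power_energy_le[OF \<alpha> k]) auto
        finally have "m' / c * (g x (u x) * ?H (u x)) \<le> deriv (g x) (u x) * (?\<eta> (u x))\<^sup>2"
          using c by (simp add: field_simps)
        then show ?thesis
          using True by (auto simp: X_def F_def intro: ennreal_leI)
      qed (auto simp: X_def F_def)
    qed
  qed
  also have "\<dots> \<le> ennreal ((p - 1) * (LINT x|lebesgue. F x))"
    unfolding FL[symmetric]
    by (rule stable_solution_test_pair[OF p stable nonneg lip(1) zero(1) lip(2) zero(2)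
          trunc_power_energy_nonneg[OF \<alpha> k] trunc_power_diff_sq_le[OF \<alpha> k]])
  finally have "m' / c * (LINT x|lebesgue. X x) \<le> (p - 1) * (LINT x|lebesgue. F x)"
    using p integral_nonneg_AE[OF Fnn] by (simp add: ennreal_le_iff)
  then have "m' * (LINT x|lebesgue. X x) \<le> (p - 1) * c * (LINT x|lebesgue. F x)"
    using c by (simp add: field_simps)
  \<comment> \<open>Absorption is legitimate because the truncation made \<open>F\<close> integrable
    beforehand.\<close>
  then have "(m' - (p - 1) * c) * (LINT x|lebesgue. F x) \<le> m' * (LINT x|lebesgue. Y x)"
    unfolding XY by (simp add: algebra_simps)
  then have F_le: "(LINT x|lebesgue. F x) \<le> m' / (m' - (p - 1) * c) * (LINT x|lebesgue. Y x)"
    using m'c by (simp add: field_simps)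
  have "(LINT x|lebesgue. Y x)
      \<le> (LINT x|lebesgue. indicat_real \<Omega> x * (C0 * (1 + A) powr m * (c * A powr (2 * \<alpha> - 1))))"
  proof (rule integral_mono_AE[OF Y])
    show "integrable lebesgue (\<lambda>x. indicat_real \<Omega> x * (C0 * (1 + A) powr m * (c * A powr (2 * \<alpha> - 1))))"
      using \<Omega> by (intro integrable_mult_left) (simp add: fmeasurable_def)
    show "AE x in lebesgue. Y x \<le> indicat_real \<Omega> x * (C0 * (1 + A) powr m * (c * A powr (2 * \<alpha> - 1)))"
      using reaction_bounds
    proof eventually_elim
      case (elim x)
      show ?case
      proof (cases "x \<in> \<Omega> \<and> u x < A")
        case True
        have "g x (u x) \<le> C0 * (1 + A) powr m"
          using elim True C0 m powr_mono2[of m "1 + u x" "1 + A"]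
          by (smt (verit) mult_left_mono)
        \<comment> \<open>By \<open>A \<le> k\<close> the energy at \<open>A\<close> is still a pure
          power, which frees the bound from \<open>k\<close>.\<close>
        moreover have "?H (u x) \<le> c * A powr (2 * \<alpha> - 1)"
          using monoD[OF mono_trunc_power_energy[OF \<alpha> k], of "u x" A] True A
          by (simp add: trunc_power_energy_below[OF \<alpha> k] c_def)
        ultimately have "g x (u x) * ?H (u x) \<le> C0 * (1 + A) powr m * (c * A powr (2 * \<alpha> - 1))"
          using elim True c C0 by (intro mult_mono trunc_power_energy_nonneg[OF \<alpha> k]) auto
        then show ?thesis using True by (simp add: Y_def F_def)
      qed (use c C0 in \<open>auto simp: Y_def F_def indicator_def\<close>)
    qed
  qed
  also have "\<dots> = C0 * (1 + A) powr m * (c * A powr (2 * \<alpha> - 1)) * measure lebesgue \<Omega>"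
    by simp
  finally have "m' / (m' - (p - 1) * c) * (LINT x|lebesgue. Y x)
      \<le> m' / (m' - (p - 1) * c)
        * (C0 * (1 + A) powr m * (c * A powr (2 * \<alpha> - 1)) * measure lebesgue \<Omega>)"
    using m'c m'0 by (intro mult_left_mono) simp_all
  with F_le show ?thesis
    unfolding FL c_def[symmetric] by (rule order_trans)
qed

text \<open>The equation tested with \<open>u\<close> itself.\<close>

lemma gagliardo_seminorm_powr:
  "gagliardo_seminorm s p u powr p = (LINT x:\<Omega>|lebesgue. g x (u x) * u x)"
proof -
  have "0 \<le> (LINT z|lebesgue. gagliardo_integrand s p u z)"
    by (intro integral_nonneg_AE) (auto simp: gagliardo_integrand_def)
  then have "gagliardo_seminorm s p u powr p = (LINT z|lebesgue. gagliardo_integrand s p u z)"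
    using p by (simp add: gagliardo_seminorm_def powr_powr)
  also have "\<dots> = frac_p_laplacian s p u u"
    unfolding frac_p_laplacian_def gagliardo_integrand_def J_def
    by (simp add: abs_powr_mult_self)
  also have "\<dots> = (LINT x:\<Omega>|lebesgue. g x (u x) * u x)"
    using frac_p_laplacian_compose[of 1 "\<lambda>t. t"] by (simp add: lipschitz_on_def)
  finally show ?thesis .
qed

section \<open>Superlevel sets and the integral of the reaction over them\<close>

definition superlevel :: "real \<Rightarrow> 'a set" where
  "superlevel t = {x \<in> \<Omega>. t < u x}"

definition level_mass :: "real \<Rightarrow> real" where
  "level_mass t = (LINT x:superlevel t|lebesgue. g x (u x))"

lemma superlevel_sets [measurable]: "superlevel t \<in> sets lebesgue"
  unfolding superlevel_def by measurable

lemma superlevel_lmeasurable: "superlevel t \<in> lmeasurable"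
  by (rule fmeasurableI2[OF \<Omega>]) (auto simp: superlevel_def)

text \<open>Since \<open>u\<close> is a test function, g(x,u) u is integrable; where
  \<open>u > t\<close> it dominates t g(x,u).\<close>

lemma set_integrable_superlevel:
  assumes "0 < t" shows "set_integrable lebesgue (superlevel t) (\<lambda>x. g x (u x))"
proof -
  have "set_integrable lebesgue \<Omega> (\<lambda>x. g x (u x) * u x)"
    using set_integrable_reaction[of 1 "\<lambda>t. t"] by (simp add: lipschitz_on_def)
  then have i: "set_integrable lebesgue (superlevel t) (\<lambda>x. g x (u x) * u x)"
    by (rule set_integrable_subset) (auto simp: superlevel_def)
  then have "(\<lambda>x. indicat_real (superlevel t) x *\<^sub>R (g x (u x) * u x)) \<in> borel_measurable lebesgue"
    by (simp add: set_integrable_def)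
  \<comment> \<open>Measurability of the reaction is recovered from the product by dividing by
    \<open>u\<close>, which is positive on the superlevel set.\<close>
  then have "(\<lambda>x. (indicat_real (superlevel t) x *\<^sub>R (g x (u x) * u x)) / u x) \<in> borel_measurable lebesgue"
    by measurable
  also have "(\<lambda>x. (indicat_real (superlevel t) x *\<^sub>R (g x (u x) * u x)) / u x)
      = (\<lambda>x. indicat_real (superlevel t) x *\<^sub>R g x (u x))"
    using assms by (auto simp: superlevel_def indicator_def)
  finally have meas: "(\<lambda>x. indicat_real (superlevel t) x *\<^sub>R g x (u x)) \<in> borel_measurable lebesgue" .
  show ?thesis
    unfolding set_integrable_def
  proof (rule Bochner_Integration.integrable_bound[OF _ meas])
    show "integrable lebesgue (\<lambda>x. (indicat_real (superlevel t) x *\<^sub>R (g x (u x) * u x)) / t)"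
      using i by (simp add: set_integrable_def)
    show "AE x in lebesgue. norm (indicat_real (superlevel t) x *\<^sub>R g x (u x))
        \<le> norm ((indicat_real (superlevel t) x *\<^sub>R (g x (u x) * u x)) / t)"
      using reaction_bounds
    proof eventually_elim
      case (elim x)
      show ?case
      proof (cases "x \<in> superlevel t")
        case True
        then have "0 \<le> g x (u x)" "t \<le> u x" using elim by (auto simp: superlevel_def)
        then have "g x (u x) * t \<le> g x (u x) * u x" by (intro mult_left_mono)
        then show ?thesis
          using True \<open>0 \<le> g x (u x)\<close> assms \<open>t \<le> u x\<close> by (simp add: field_simps abs_mult)
      qed simp
    qed
  qed
qed

text \<open>Markov's inequality for the measure with density g(x,u).\<close>

lemma level_mass_le_reaction:
  assumes f: "L-lipschitz_on UNIV f" "f 0 = 0" "mono f" and t: "0 < t"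
  shows "f t * level_mass t \<le> (LINT x:\<Omega>|lebesgue. g x (u x) * f (u x))"
proof -
  have "f t * level_mass t = (LINT x:superlevel t|lebesgue. f t * g x (u x))"
    by (simp add: level_mass_def)
  also have "\<dots> \<le> (LINT x:\<Omega>|lebesgue. g x (u x) * f (u x))"
    unfolding set_lebesgue_integral_def
  proof (rule integral_mono_AE)
    show "integrable lebesgue (\<lambda>x. indicat_real (superlevel t) x *\<^sub>R (f t * g x (u x)))"
      using set_integrable_mult_right[OF set_integrable_superlevel[OF t], of "f t"]
      by (simp add: set_integrable_def)
    show "integrable lebesgue (\<lambda>x. indicat_real \<Omega> x *\<^sub>R (g x (u x) * f (u x)))"
      using set_integrable_reaction[OF f(1,2)] by (simp add: set_integrable_def)
    show "AE x in lebesgue. indicat_real (superlevel t) x *\<^sub>R (f t * g x (u x))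
        \<le> indicat_real \<Omega> x *\<^sub>R (g x (u x) * f (u x))"
      using reaction_bounds
    proof eventually_elim
      case (elim x)
      have "0 \<le> f (u x)" if "x \<in> \<Omega>"
        using monoD[OF f(3), of 0 "u x"] f(2) elim that by auto
      moreover have "f t \<le> f (u x)" if "x \<in> superlevel t"
        using monoD[OF f(3), of t "u x"] that by (auto simp: superlevel_def)
      ultimately show ?case
        using elim by (auto simp: indicator_def superlevel_def mult.commute[of "g x (u x)"]
            intro!: mult_right_mono)
    qed
  qed
  finally show ?thesis .
qed

end

section \<open>Level sets\<close>

text \<open>Around each \<open>x\<close> in \<open>A\<close> the ball of radius \<open>R\<close> has
  volume at least b + |B|, so a portion of measure at least \<open>b\<close> lies outside
  \<open>B\<close>, and there \<open>f\<close> is at least \<open>c\<close>. Tonelli's theorem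
  integrates this over \<open>A\<close>.\<close>

lemma nn_integral_near_complement:
  fixes A B :: "'a::euclidean_space set" and f :: "'a \<times> 'a \<Rightarrow> ennreal"
  assumes A: "A \<in> sets lebesgue" and B: "B \<in> sets lebesgue"
    and f: "\<And>x y. x \<in> A \<Longrightarrow> y \<notin> B \<Longrightarrow> dist x y < R \<Longrightarrow> c \<le> f (x, y)"
    and b: "b + emeasure lebesgue B \<le> ennreal (unit_ball_vol (real DIM('a)) * R ^ DIM('a))"
    and B_fin: "emeasure lebesgue B \<noteq> \<infinity>" and R: "0 \<le> R"
  shows "c * (b * emeasure lebesgue A) \<le> (\<integral>\<^sup>+z. f z \<partial>lebesgue)"
proof -
  \<comment> \<open>Borel subsets of full measure in \<open>A\<close> and in the complement of
    \<open>B\<close>, since slices are measured by \<open>lborel\<close>.\<close>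
  define A' where "A' = main_part lborel A"
  define D where "D = main_part lborel (- B)"
  have nB: "- B \<in> sets lebesgue" using B by (simp add: Compl_in_sets_lebesgue)
  have A': "A' \<in> sets borel" "A' \<subseteq> A" "emeasure lborel A' = emeasure lebesgue A"
    using main_part_sets[OF A] main_part_null_part_Un[OF A] emeasure_completion[OF A]
    by (auto simp: A'_def)
  have D: "D \<in> sets borel" "D \<subseteq> - B"
    using main_part_sets[OF nB] main_part_null_part_Un[OF nB] by (auto simp: D_def)
  have D_ball: "b \<le> emeasure lborel (D \<inter> ball x R)" for x
  proof -
    have "null_part lborel (- B) \<in> null_sets lebesgue"
      using null_part_null_sets[OF nB] by (auto intro: null_sets_completionI dest: null_part_null_sets)
    then have null: "emeasure lebesgue (null_part lborel (- B)) = 0"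
      and [measurable]: "null_part lborel (- B) \<in> sets lebesgue" by auto
    have [measurable]: "D \<in> sets lebesgue" "ball x R \<in> sets lebesgue" using D by auto
    note [measurable] = B
    have "D \<union> null_part lborel (- B) = - B"
      unfolding D_def by (rule main_part_null_part_Un[OF nB])
    then have sub: "ball x R \<subseteq> (D \<inter> ball x R) \<union> (null_part lborel (- B) \<union> B)"
      by blast
    have "b + emeasure lebesgue B \<le> emeasure lebesgue (ball x R)"
      using b R by (simp add: emeasure_ball)
    also have "\<dots> \<le> emeasure lebesgue ((D \<inter> ball x R) \<union> (null_part lborel (- B) \<union> B))"
      using sub by (intro emeasure_mono) auto
    also have "\<dots> \<le> emeasure lebesgue (D \<inter> ball x R) + emeasure lebesgue (null_part lborel (- B) \<union> B)"
      by (intro emeasure_subadditive) auto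
    also have "emeasure lebesgue (null_part lborel (- B) \<union> B)
        \<le> emeasure lebesgue (null_part lborel (- B)) + emeasure lebesgue B"
      by (intro emeasure_subadditive) auto
    finally have "emeasure lebesgue B + b \<le> emeasure lebesgue B + emeasure lebesgue (D \<inter> ball x R)"
      unfolding null by (simp add: add.commute add_left_mono)
    then have "b \<le> emeasure lebesgue (D \<inter> ball x R)"
      using B_fin by (simp add: ennreal_add_left_cancel_le)
    then show ?thesis using D by simp
  qed
  define E where "E = {z. fst z \<in> A' \<and> snd z \<in> D \<and> dist (fst z) (snd z) < R}"
  have E: "E \<in> sets (borel :: ('a \<times> 'a) measure)"
  proof -
    have "open {z :: 'a \<times> 'a. dist (fst z) (snd z) < R}"
      by (intro open_Collect_less continuous_intros)
    moreover have "A' \<times> D \<in> sets (borel :: ('a \<times> 'a) measure)"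
      using A' D by (simp add: borel_prod[symmetric])
    moreover have "E = (A' \<times> D) \<inter> {z. dist (fst z) (snd z) < R}"
      by (auto simp: E_def)
    ultimately show ?thesis by auto
  qed
  have "b * emeasure lebesgue A = (\<integral>\<^sup>+x. b * indicator A' x \<partial>lborel)"
    using A' by (simp add: nn_integral_cmult_indicator)
  also have "\<dots> \<le> (\<integral>\<^sup>+x. emeasure lborel (Pair x -` E) \<partial>lborel)"
  proof (rule nn_integral_mono)
    fix x
    have "Pair x -` E = D \<inter> ball x R" if "x \<in> A'"
      using that by (auto simp: E_def)
    then show "b * indicator A' x \<le> emeasure lborel (Pair x -` E)"
      using D_ball by (auto simp: indicator_def)
  qed
  also have "\<dots> = emeasure (lborel \<Otimes>\<^sub>M lborel) E"
    using E by (intro lborel.emeasure_pair_measure_alt[symmetric]) (simp only: lborel_prod sets_lborel)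
  also have "\<dots> = emeasure lborel E" by (simp add: lborel_prod)
  finally have "c * (b * emeasure lebesgue A) \<le> c * emeasure lborel E"
    by (rule mult_left_mono) simp
  also have "\<dots> = (\<integral>\<^sup>+z. c * indicator E z \<partial>lborel)"
    using E by (simp add: nn_integral_cmult_indicator)
  also have "\<dots> \<le> (\<integral>\<^sup>+z. f z \<partial>lborel)"
  proof (rule nn_integral_mono)
    fix z
    have "c \<le> f z" if "z \<in> E"
      using f[of "fst z" "snd z"] that A' D by (auto simp: E_def)
    then show "c * indicator E z \<le> f z"
      by (simp add: indicator_def)
  qed
  finally show ?thesis
    by (simp add: nn_integral_completion)
qed

context nonneg_stable_solution
begin

text \<open>For \<open>x\<close> in {u > h} and \<open>y\<close> in {u \<le> k} at distance below
  \<open>R\<close>, the tested integrand is at least (h-k)^p / R^(N+sp). Such \<open>y\<close> fill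
  measure at least |{u > k}| around each \<open>x\<close>, while the equation bounds the whole
  integral by (h-k) times the level mass.\<close>

lemma superlevel_decay:
  assumes kh: "0 < k" "k < h"
  defines "\<sigma> \<equiv> s * p / real DIM('a)"
  shows "(h - k) powr (p - 1) * measure lebesgue (superlevel h)
    \<le> (2 / unit_ball_vol (real DIM('a))) powr (1 + \<sigma>)
        * measure lebesgue (superlevel k) powr \<sigma> * level_mass k"
proof -
  define N where "N = real DIM('a)"
  define \<omega> where "\<omega> = unit_ball_vol N"
  define a where "a = measure lebesgue (superlevel h)"
  define b where "b = measure lebesgue (superlevel k)"
  have N: "0 < N" by (simp add: N_def)
  have \<omega>: "0 < \<omega>" using N by (simp add: \<omega>_def)
  have ab: "a \<le> b"
    unfolding a_def b_def using kh
    by (intro measure_mono_fmeasurable superlevel_lmeasurable superlevel_sets) (auto simp: superlevel_def)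
  have a0: "0 \<le> a" by (simp add: a_def)
  let ?w = "\<lambda>t. max 0 (min t h - k)"
  have w: "1-lipschitz_on UNIV ?w"
    by (rule lipschitz_onI) (auto simp: dist_real_def)
  let ?I = "\<lambda>(x, y). J p u x y * (?w (u x) - ?w (u y)) / gagliardo_denom s p x y"
  have J_nonneg: "0 \<le> J p u x y * (?w (u x) - ?w (u y))" for x y
  proof -
    have "0 \<le> (u x - u y) * (?w (u x) - ?w (u y))"
      using mult_nonneg_nonneg[of "u x - u y" "?w (u x) - ?w (u y)"]
        mult_nonpos_nonpos[of "u x - u y" "?w (u x) - ?w (u y)"]
      by (cases "u x \<le> u y") auto
    then show ?thesis
      unfolding J_def mult.assoc by simp
  qed
  have "frac_p_laplacian s p u (\<lambda>x. ?w (u x)) = (LINT x:\<Omega>|lebesgue. g x (u x) * ?w (u x))"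
    using kh by (intro frac_p_laplacian_compose[OF w]) auto
  also have "\<dots> \<le> (LINT x:superlevel k|lebesgue. g x (u x) * (h - k))"
    unfolding set_lebesgue_integral_def
  proof (rule integral_mono_AE)
    show "integrable lebesgue (\<lambda>x. indicat_real \<Omega> x *\<^sub>R (g x (u x) * ?w (u x)))"
      using set_integrable_reaction[OF w] kh by (simp add: set_integrable_def)
    show "integrable lebesgue (\<lambda>x. indicat_real (superlevel k) x *\<^sub>R (g x (u x) * (h - k)))"
      using set_integrable_mult_left[OF set_integrable_superlevel[OF kh(1)], of "h - k"]
      by (simp add: set_integrable_def)
    show "AE x in lebesgue. indicat_real \<Omega> x *\<^sub>R (g x (u x) * ?w (u x))
        \<le> indicat_real (superlevel k) x *\<^sub>R (g x (u x) * (h - k))"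
      using reaction_bounds
      by eventually_elim (use kh in \<open>auto simp: superlevel_def indicator_def intro!: mult_left_mono\<close>)
  qed
  also have "\<dots> = (h - k) * level_mass k"
    by (simp add: level_mass_def mult.commute)
  finally have upper: "frac_p_laplacian s p u (\<lambda>x. ?w (u x)) \<le> (h - k) * level_mass k" .
  have nn: "(\<integral>\<^sup>+z. ennreal (?I z) \<partial>lebesgue) = ennreal (frac_p_laplacian s p u (\<lambda>x. ?w (u x)))"
    unfolding frac_p_laplacian_def
    by (rule nn_integral_eq_integral[OF integrable_J_lipschitz[OF u_W0sp w]])
      (auto intro!: divide_nonneg_nonneg J_nonneg)
  have \<sigma>: "0 \<le> \<sigma>" "N + s * p = N * (1 + \<sigma>)"
    using p s N by (simp_all add: \<sigma>_def N_def[symmetric] field_simps)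
  have "(h - k) powr (p - 1) * a \<le> (2 / \<omega>) powr (1 + \<sigma>) * b powr \<sigma> * level_mass k"
  proof (cases "b = 0")
    case True
    then show ?thesis using ab a0 by simp
  next
    case False
    then have b: "0 < b" using ab a0 by simp
    \<comment> \<open>Balls of radius \<open>R\<close> have volume \<open>2 * b\<close>, so {u > k}
      leaves at least \<open>b\<close> of each.\<close>
    define R where "R = (2 * b / \<omega>) powr (1 / N)"
    have R: "0 < R" using b \<omega> by (simp add: R_def)
    have RN: "\<omega> * R ^ DIM('a) = 2 * b"
      using R b \<omega> N by (simp add: R_def powr_powr N_def[symmetric] flip: powr_realpow)
    define q where "q = (h - k) powr p / R powr (N + s * p)"
    have q: "0 < q" using kh R by (simp add: q_def)
    have Bm: "{x. k < u x} \<in> sets lebesgue"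
    proof -
      have "{x \<in> space lebesgue. k < u x} \<in> sets lebesgue" by measurable
      then show ?thesis by simp
    qed
    \<comment> \<open>The balls may leave \<Omega>, so the set is taken in the whole space; as
      \<open>k > 0\<close> and \<open>u\<close> vanishes outside \<Omega>, its measure is
      unchanged.\<close>
    have B: "emeasure lebesgue {x. k < u x} = ennreal b"
    proof -
      have "AE x in lebesgue. x \<notin> \<Omega> \<longrightarrow> u x = 0"
        using u_W0sp by (simp add: W0sp_def)
      then have "AE x in lebesgue. x \<in> {x. k < u x} \<longleftrightarrow> x \<in> superlevel k"
        by eventually_elim (use kh in \<open>auto simp: superlevel_def\<close>)
      then have "emeasure lebesgue {x. k < u x} = emeasure lebesgue (superlevel k)"
        using Bm by (intro emeasure_eq_AE) auto
      then show ?thesis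
        using superlevel_lmeasurable by (simp add: b_def emeasure_eq_measure2)
    qed
    have "ennreal q * (ennreal b * emeasure lebesgue (superlevel h)) \<le> (\<integral>\<^sup>+z. ennreal (?I z) \<partial>lebesgue)"
    proof (rule nn_integral_near_complement[where R = R, OF superlevel_sets Bm])
      fix x y assume x: "x \<in> superlevel h" and y: "y \<notin> {x. k < u x}" and R': "dist x y < R"
      have uu: "h < u x" "u y \<le> k" using x y by (auto simp: superlevel_def)
      then have ne: "x \<noteq> y" using kh by auto
      define d where "d = u x - u y"
      have d: "h - k \<le> d" "0 < d" using uu kh by (auto simp: d_def)
      have "(h - k) powr p = (h - k) powr (p - 1) * (h - k)"
        using kh powr_mult_base[of "h - k" "p - 1"] by (simp add: mult.commute)
      also have "\<dots> \<le> d powr (p - 1) * (h - k)"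
        using d kh p by (intro mult_right_mono powr_mono2) auto
      also have "d powr (p - 1) = d powr (p - 2) * d"
        using d powr_mult_base[of d "p - 2"] by (simp add: mult.commute)
      also have "d powr (p - 2) * d * (h - k) = J p u x y * (?w (u x) - ?w (u y))"
        using uu kh d by (simp add: J_def d_def)
      finally have num: "(h - k) powr p \<le> J p u x y * (?w (u x) - ?w (u y))" .
      have "gagliardo_denom s p x y \<le> R powr (N + s * p)"
        unfolding gagliardo_denom_def N_def using R' s p
        by (intro powr_mono2) (auto simp: dist_norm)
      moreover have "0 < gagliardo_denom s p x y"
        using ne by (simp add: gagliardo_denom_def)
      ultimately have "q \<le> J p u x y * (?w (u x) - ?w (u y)) / gagliardo_denom s p x y"
        unfolding q_def using num J_nonneg by (intro frac_le) auto
      then show "ennreal q \<le> ennreal (?I (x, y))"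
        by (simp add: ennreal_leI)
    next
      show "ennreal b + emeasure lebesgue {x. k < u x}
          \<le> ennreal (unit_ball_vol (real DIM('a)) * R ^ DIM('a))"
        using RN b by (simp add: B \<omega>_def N_def flip: ennreal_plus)
    qed (use B R in auto)
    also have "ennreal q * (ennreal b * emeasure lebesgue (superlevel h)) = ennreal (q * b * a)"
      using superlevel_lmeasurable q b a0
      by (simp add: a_def emeasure_eq_measure2 ennreal_mult mult.assoc)
    finally have "ennreal (q * b * a) \<le> ennreal (frac_p_laplacian s p u (\<lambda>x. ?w (u x)))"
      unfolding nn .
    moreover have "0 \<le> frac_p_laplacian s p u (\<lambda>x. ?w (u x))"
      unfolding frac_p_laplacian_def
      by (intro integral_nonneg_AE) (auto intro!: divide_nonneg_nonneg J_nonneg)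
    ultimately have le: "q * b * a \<le> (h - k) * level_mass k"
      using upper by (simp add: ennreal_le_iff)
    \<comment> \<open>Uses N + sp = N (1 + \<sigma>); the separate factor \<open>b\<close> is
      cancelled at the end.\<close>
    have RN': "R powr (N + s * p) = (2 / \<omega>) powr (1 + \<sigma>) * (b * b powr \<sigma>)"
    proof -
      have "R powr (N + s * p) = (2 * b / \<omega>) powr (1 + \<sigma>)"
        unfolding R_def \<sigma>(2) powr_powr using N by simp
      also have "\<dots> = (2 / \<omega>) powr (1 + \<sigma>) * b powr (1 + \<sigma>)"
        using b \<omega> by (simp add: powr_mult[symmetric])
      finally show ?thesis using b by (simp add: powr_add)
    qed
    have "((h - k) * b) * ((h - k) powr (p - 1) * a) = (h - k) powr p * b * a"
      using kh powr_mult_base[of "h - k" "p - 1"] by (simp add: mult.assoc mult.left_commute)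
    also have "(h - k) powr p = q * R powr (N + s * p)"
      using R by (simp add: q_def)
    also have "q * R powr (N + s * p) * b * a = q * b * a * R powr (N + s * p)"
      by simp
    also have "\<dots> \<le> (h - k) * level_mass k * R powr (N + s * p)"
      using le by (rule mult_right_mono) simp
    also have "\<dots> = ((h - k) * b) * ((2 / \<omega>) powr (1 + \<sigma>) * b powr \<sigma> * level_mass k)"
      unfolding RN' by simp
    finally have "((h - k) * b) * ((h - k) powr (p - 1) * a)
        \<le> ((h - k) * b) * ((2 / \<omega>) powr (1 + \<sigma>) * b powr \<sigma> * level_mass k)" .
    then show ?thesis using kh b by (simp add: mult_le_cancel_left_pos)
  qed
  then show ?thesis
    by (simp add: a_def b_def \<omega>_def N_def)
qed

text \<open>Where \<open>u \<le> T\<close> the growth condition bounds the reaction; the rest lies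
  in the superlevel set of \<open>T\<close>.\<close>

lemma level_mass_split:
  assumes k: "0 < k" and T: "0 < T"
  shows "level_mass k \<le> C0 * (1 + T) powr m * measure lebesgue (superlevel k) + level_mass T"
proof -
  let ?c = "C0 * (1 + T) powr m"
  have 1: "integrable lebesgue (\<lambda>x. indicat_real (superlevel k) x * ?c)"
    using superlevel_lmeasurable[of k] by (intro integrable_mult_left) (simp add: fmeasurable_def)
  have 2: "integrable lebesgue (\<lambda>x. indicat_real (superlevel T) x *\<^sub>R g x (u x))"
    using set_integrable_superlevel[OF T] by (simp add: set_integrable_def)
  have "level_mass k \<le> (LINT x|lebesgue. indicat_real (superlevel k) x * ?c
      + indicat_real (superlevel T) x *\<^sub>R g x (u x))"
    unfolding level_mass_def set_lebesgue_integral_def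
  proof (rule integral_mono_AE[OF _ Bochner_Integration.integrable_add[OF 1 2]])
    show "integrable lebesgue (\<lambda>x. indicat_real (superlevel k) x *\<^sub>R g x (u x))"
      using set_integrable_superlevel[OF k] by (simp add: set_integrable_def)
    show "AE x in lebesgue. indicat_real (superlevel k) x *\<^sub>R g x (u x)
        \<le> indicat_real (superlevel k) x * ?c + indicat_real (superlevel T) x *\<^sub>R g x (u x)"
      using reaction_bounds
    proof eventually_elim
      case (elim x)
      show ?case
      proof (cases "x \<in> superlevel k")
        case True
        then have x: "x \<in> \<Omega>" by (simp add: superlevel_def)
        have c: "0 \<le> ?c" using C0 by simp
        show ?thesis
        proof (cases "u x \<le> T")
          case True
          then have "C0 * (1 + u x) powr m \<le> ?c"
            using elim x C0 m by (intro mult_left_mono powr_mono2) auto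
          then have "g x (u x) \<le> ?c" using elim x by force
          then show ?thesis using elim x by (auto simp: indicator_def)
        next
          case False
          then have "x \<in> superlevel T" using x by (simp add: superlevel_def)
          then show ?thesis using c \<open>x \<in> superlevel k\<close> by simp
        qed
      next
        case False
        have "0 \<le> indicat_real (superlevel T) x *\<^sub>R g x (u x)"
          using elim by (cases "x \<in> superlevel T") (auto simp: superlevel_def)
        then show ?thesis using False by simp
      qed
    qed
  qed
  also have "\<dots> = ?c * measure lebesgue (superlevel k) + level_mass T"
    using Bochner_Integration.integral_add[OF 1 2]
    by (simp add: level_mass_def set_lebesgue_integral_def)
  finally show ?thesis .
qed

text \<open>Sums over the dyadic layers \<open>2\<^sup>j k < u \<le> 2\<^sup>j\<^sup>+\<^sup>1 k\<close>.\<close>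

lemma level_mass_le_tail:
  assumes k: "1 \<le> k" and \<kappa>: "m < \<kappa>" and K: "0 \<le> K"
    and tail: "\<And>t. k \<le> t \<Longrightarrow> measure lebesgue (superlevel t) \<le> K * t powr - \<kappa>"
  shows "level_mass k \<le> C0 * 4 powr m / (1 - 2 powr (m - \<kappa>)) * K * k powr (m - \<kappa>)"
proof -
  \<comment> \<open>The ratio of the geometric series of layers, below 1 because
    \<open>m < \<kappa>\<close>.\<close>
  define r :: real where "r = 2 powr (m - \<kappa>)"
  have r: "0 < r" "r < 1" using \<kappa> by (simp_all add: r_def powr_less_one)
  define l where "l j = 2 ^ j * k" for j :: nat
  have l: "k \<le> l j" "1 \<le> l j" for j
  proof -
    have "1 * k \<le> 2 ^ j * k" using k by (intro mult_right_mono) auto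
    then show "k \<le> l j" by (simp only: l_def mult_1)
    with k show "1 \<le> l j" by (rule order_trans)
  qed
  define w where "w j = C0 * (1 + l (Suc j)) powr m" for j
  have w0: "0 \<le> w j" for j using C0 by (simp add: w_def)
  define M where "M = C0 * 4 powr m * K * k powr (m - \<kappa>)"
  have M: "0 \<le> M" using C0 K by (simp add: M_def)
  have term_le: "w j * measure lebesgue (superlevel (l j)) \<le> M * r ^ j" for j
  proof -
    have "l (Suc j) = 2 * l j" by (simp add: l_def)
    \<comment> \<open>Source of the factor \<open>4 powr m\<close>: \<open>1\<close> and
      \<open>2 * l j\<close> are absorbed into \<open>4 * l j\<close>, as
      \<open>l j \<ge> 1\<close>.\<close>
    then have "1 + l (Suc j) \<le> 4 * l j" using l(2)[of j] by linarith
    then have "(1 + l (Suc j)) powr m \<le> (4 * l j) powr m"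
      using m l(2)[of "Suc j"] by (intro powr_mono2) linarith+
    then have "w j \<le> C0 * (4 * l j) powr m"
      using C0 by (simp add: w_def)
    then have "w j * measure lebesgue (superlevel (l j)) \<le> C0 * (4 * l j) powr m * (K * l j powr - \<kappa>)"
      using tail[OF l(1)[of j]] w0 C0 by (intro mult_mono) auto
    also have "\<dots> = C0 * 4 powr m * K * (l j powr m * l j powr - \<kappa>)"
      using l(2)[of j] by (simp add: powr_mult)
    also have "l j powr m * l j powr - \<kappa> = l j powr (m - \<kappa>)"
      by (simp flip: powr_add)
    also have "\<dots> = r ^ j * k powr (m - \<kappa>)"
    proof -
      have "(2 ^ j) powr (m - \<kappa>) = r ^ j"
        by (simp add: r_def powr_powr powr_realpow[symmetric] mult.commute)
      then show ?thesis using k by (simp add: l_def powr_mult)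
    qed
    finally show ?thesis by (simp add: M_def mult_ac)
  qed
  have "ennreal (level_mass k) = (\<integral>\<^sup>+x. ennreal (indicat_real (superlevel k) x *\<^sub>R g x (u x)) \<partial>lebesgue)"
    unfolding level_mass_def set_lebesgue_integral_def
  proof (rule nn_integral_eq_integral[symmetric])
    show "integrable lebesgue (\<lambda>x. indicat_real (superlevel k) x *\<^sub>R g x (u x))"
      using set_integrable_superlevel[of k] k by (simp add: set_integrable_def)
    show "AE x in lebesgue. 0 \<le> indicat_real (superlevel k) x *\<^sub>R g x (u x)"
      using reaction_bounds by eventually_elim (auto simp: indicator_def superlevel_def)
  qed
  also have "\<dots> \<le> (\<integral>\<^sup>+x. (\<Sum>j. ennreal (w j) * indicator (superlevel (l j)) x) \<partial>lebesgue)"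
  proof (rule nn_integral_mono_AE)
    show "AE x in lebesgue. ennreal (indicat_real (superlevel k) x *\<^sub>R g x (u x))
        \<le> (\<Sum>j. ennreal (w j) * indicator (superlevel (l j)) x)"
      using reaction_bounds
    proof eventually_elim
      case (elim x)
      show ?case
      proof (cases "x \<in> superlevel k")
        case True
        then have x: "x \<in> \<Omega>" "k < u x" by (simp_all add: superlevel_def)
        \<comment> \<open>The layer of \<open>x\<close>: \<open>n\<close> is positive because
          \<open>l 0 = k < u x\<close>, and its predecessor \<open>j\<close> gives
          \<open>l j < u x \<le> l (Suc j)\<close>.\<close>
        define n where "n = (LEAST n. u x \<le> l n)"
        obtain n0 :: nat where "u x < 2 ^ n0"
          using real_arch_pow[of 2 "u x"] by auto
        moreover have "2 ^ n0 * 1 \<le> 2 ^ n0 * k" using k by (intro mult_left_mono) auto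
        ultimately have "u x \<le> l n0" unfolding l_def by linarith
        then have n: "u x \<le> l n" unfolding n_def by (rule LeastI)
        have "n \<noteq> 0"
        proof
          assume "n = 0"
          with n x show False by (simp add: l_def)
        qed
        then obtain j where j: "n = Suc j" by (cases n) auto
        have "\<not> u x \<le> l j"
          using not_less_Least[of j "\<lambda>n. u x \<le> l n"] j by (simp add: n_def)
        then have xj: "x \<in> superlevel (l j)" using x by (simp add: superlevel_def)
        have "C0 * (1 + u x) powr m \<le> w j"
          unfolding w_def using n j elim x C0 m by (intro mult_left_mono powr_mono2) auto
        then have "ennreal (g x (u x)) \<le> ennreal (w j) * indicator (superlevel (l j)) x"
          using elim x xj by (auto intro: ennreal_leI)
        also have "\<dots> \<le> (\<Sum>j. ennreal (w j) * indicator (superlevel (l j)) x)"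
          using sum_le_suminf[OF summableI, of "{j}" "\<lambda>j. ennreal (w j) * indicator (superlevel (l j)) x"]
          by (simp only: sum.insert[OF finite.emptyI] empty_iff not_False_eq_True sum.empty
              add_0_right finite.intros zero_le simp_thms)
        finally show ?thesis using True by simp
      qed simp
    qed
  qed
  also have "\<dots> = (\<Sum>j. \<integral>\<^sup>+x. ennreal (w j) * indicator (superlevel (l j)) x \<partial>lebesgue)"
    by (rule nn_integral_suminf) simp
  also have "\<dots> = (\<Sum>j. ennreal (w j * measure lebesgue (superlevel (l j))))"
    using superlevel_lmeasurable w0
    by (simp add: nn_integral_cmult_indicator emeasure_eq_measure2 ennreal_mult)
  also have "\<dots> \<le> (\<Sum>j. ennreal (M * r ^ j))"
    using term_le by (intro suminf_le ennreal_leI) auto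
  also have "\<dots> = ennreal (M * (1 / (1 - r)))"
  proof (rule suminf_ennreal_eq)
    show "(\<lambda>j. M * r ^ j) sums (M * (1 / (1 - r)))"
      using r by (intro sums_mult geometric_sums) auto
  qed (use M r in auto)
  finally have "level_mass k \<le> M * (1 / (1 - r))"
    using M r by (subst (asm) ennreal_le_iff) auto
  then show ?thesis
    by (simp add: M_def r_def)
qed

lemma Linf_norm_le:
  assumes "measure lebesgue (superlevel K) = 0"
  shows "Linf_norm \<Omega> u \<le> ereal K"
  unfolding Linf_norm_def
proof (rule esssup_I)
  show "(\<lambda>x. ereal \<bar>u x\<bar>) \<in> borel_measurable (lebesgue_on \<Omega>)"
    by (rule measurable_restrict_space1) measurable
  have "superlevel K \<in> null_sets lebesgue"
    using assms superlevel_lmeasurable[of K] by (auto simp: null_sets_def emeasure_eq_measure2)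
  then have "AE x in lebesgue. x \<notin> superlevel K"
    by (rule AE_not_in)
  then have "AE x in lebesgue. x \<in> \<Omega> \<longrightarrow> ereal \<bar>u x\<bar> \<le> ereal K"
    using nonneg by eventually_elim (auto simp: superlevel_def)
  then show "AE x in lebesgue_on \<Omega>. ereal \<bar>u x\<bar> \<le> ereal K"
    by (subst AE_restrict_space_iff) (auto elim: eventually_mono)
qed

text \<open>The weight is evaluated at its own truncation level, where it is still the pure
  power.\<close>

lemma level_mass_markov:
  assumes \<alpha>: "1 \<le> \<alpha>" and k: "0 < k"
    and le: "(LINT x:\<Omega>|lebesgue. g x (u x) * trunc_power_energy \<alpha> k (u x)) \<le> K"
  shows "level_mass k \<le> K / (\<alpha>\<^sup>2 / (2 * \<alpha> - 1)) * k powr - (2 * \<alpha> - 1)"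
proof -
  have c: "0 < \<alpha>\<^sup>2 / (2 * \<alpha> - 1)" using \<alpha> by simp
  have "\<alpha>\<^sup>2 / (2 * \<alpha> - 1) * k powr (2 * \<alpha> - 1) * level_mass k \<le> K"
    using level_mass_le_reaction[OF lipschitz_trunc_power(2)[OF \<alpha> k] trunc_power_0(2)[OF \<alpha> k]
        mono_trunc_power_energy[OF \<alpha> k] k] le k
    by (simp add: trunc_power_energy_below[OF \<alpha> k])
  moreover have "0 < \<alpha>\<^sup>2 / (2 * \<alpha> - 1) * k powr (2 * \<alpha> - 1)"
    using c k by (intro mult_pos_pos) auto
  ultimately have "level_mass k \<le> K / (\<alpha>\<^sup>2 / (2 * \<alpha> - 1) * k powr (2 * \<alpha> - 1))"
    by (simp only: pos_le_divide_eq mult.commute)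
  then show ?thesis
    by (simp only: powr_minus_divide times_divide_eq_right mult_1_right divide_divide_eq_left)
qed

text \<open>For exponent 1 the energy is the identity on nonnegative arguments, so the integral is
  the \<open>p\<close>-th power of the seminorm.\<close>

lemma seminorm_le:
  assumes A: "0 < A"
    and le: "(LINT x:\<Omega>|lebesgue. g x (u x) * trunc_power_energy 1 A (u x)) \<le> K"
  shows "gagliardo_seminorm s p u \<le> K powr (1 / p)"
proof -
  have "(LINT x:\<Omega>|lebesgue. g x (u x) * trunc_power_energy 1 A (u x))
      = (LINT x:\<Omega>|lebesgue. g x (u x) * u x)"
  proof -
    have id: "trunc_power_energy 1 A t = t" if "0 \<le> t" for t
      using that A by (simp add: trunc_power_energy_def)
    have i: "set_integrable lebesgue \<Omega> (\<lambda>x. g x (u x) * trunc_power_energy 1 A (u x))"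
      using set_integrable_reaction[OF lipschitz_trunc_power(2)[of 1 A] trunc_power_0(2)[of 1 A]] A by simp
    have j: "set_integrable lebesgue \<Omega> (\<lambda>x. g x (u x) * u x)"
      using set_integrable_reaction[of 1 "\<lambda>t. t"] by (simp add: lipschitz_on_def)
    show ?thesis
      unfolding set_lebesgue_integral_def
    proof (rule integral_cong_AE)
      show "AE x in lebesgue. indicat_real \<Omega> x *\<^sub>R (g x (u x) * trunc_power_energy 1 A (u x))
          = indicat_real \<Omega> x *\<^sub>R (g x (u x) * u x)"
        using nonneg by eventually_elim (simp add: id)
    qed (use i j in \<open>auto simp: set_integrable_def\<close>)
  qed
  then have "gagliardo_seminorm s p u powr p \<le> K"
    using le gagliardo_seminorm_powr by simp
  then have "(gagliardo_seminorm s p u powr p) powr (1 / p) \<le> K powr (1 / p)"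
    using p by (intro powr_mono2) auto
  moreover have "0 \<le> gagliardo_seminorm s p u"
    by (simp add: gagliardo_seminorm_def)
  ultimately show ?thesis
    using p by (simp add: powr_powr)
qed

end

text \<open>With P = p - 1 and \<nu> = N / (s p), the second conclusion places \<alpha> strictly
  between the roots (m - r) / P and (m + r) / P, and 1 lies between them too. The hypothesis on
  \<nu> says that the lower bound on \<alpha> demanded by the third conclusion is below the larger
  root.\<close>

lemma exists_stable_exponent:
  fixes P m \<nu> :: real
  assumes P: "0 < P" "P < m"
    and \<nu>: "\<nu> * P * (m - P) < 2 * m - P + m * P + 2 * sqrt (m * (m - P))"
  obtains \<alpha> where "1 \<le> \<alpha>" "P * \<alpha>\<^sup>2 < m * (2 * \<alpha> - 1)" "\<nu> * (m - P) < m + 2 * \<alpha> - 1"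
proof -
  define r where "r = sqrt (m * (m - P))"
  have r: "0 < r" "r\<^sup>2 = m * (m - P)" using P by (simp_all add: r_def)
  have "(m - P)\<^sup>2 < r\<^sup>2"
    unfolding r(2) using P by (simp add: power2_eq_square)
  then have rm: "m - P < r" using r(1) by (simp add: power_less_imp_less_base)
  define \<alpha>0 where "\<alpha>0 = max 1 ((\<nu> * (m - P) - m + 1) / 2)"
  define \<alpha>1 where "\<alpha>1 = (m + r) / P"
  have "P * ((\<nu> * (m - P) - m + 1) / 2) < m + r"
    using \<nu>[folded r_def] by (simp add: algebra_simps)
  then have "\<alpha>0 < \<alpha>1"
    using P r rm by (simp add: \<alpha>0_def \<alpha>1_def field_simps)
  then obtain \<alpha> where \<alpha>: "\<alpha>0 < \<alpha>" "\<alpha> < \<alpha>1" using dense by blast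
  have a1: "1 \<le> \<alpha>" "\<nu> * (m - P) < m + 2 * \<alpha> - 1" using \<alpha>(1) by (auto simp: \<alpha>0_def)
  have "P * \<alpha> < m + r" using \<alpha>(2) P by (simp add: \<alpha>1_def field_simps)
  moreover have "m - r < P * \<alpha>" using rm a1(1) P by (smt (verit) mult_le_cancel_left1)
  ultimately have "\<bar>P * \<alpha> - m\<bar> < r" by linarith
  then have "(P * \<alpha> - m)\<^sup>2 < r\<^sup>2"
    using power_strict_mono[of "\<bar>P * \<alpha> - m\<bar>" r 2] by simp
  \<comment> \<open>Multiplication by \<open>P\<close> completes the square.\<close>
  then have "P * (P * \<alpha>\<^sup>2) < P * (m * (2 * \<alpha> - 1))"
    unfolding r(2) by (simp add: power2_eq_square algebra_simps)
  then have "P * \<alpha>\<^sup>2 < m * (2 * \<alpha> - 1)" using P by simp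
  with a1 show ?thesis using that by blast
qed

section \<open>Iteration over the levels\<close>

text \<open>Along the levels A + d (1 - 2^(-n)) the values decay geometrically, at least like B
  \<rho>^n; \<open>d\<close> is just large enough for the gain in the exponent to beat the shrinking
  level gaps.\<close>

lemma stampacchia:
  fixes a :: "real \<Rightarrow> real"
  assumes q: "0 < q" and \<delta>: "0 < \<delta>" and C: "0 \<le> C" and B: "0 < B"
    and a: "\<And>k. A \<le> k \<Longrightarrow> 0 \<le> a k" "\<And>k. A \<le> k \<Longrightarrow> a k \<le> B"
    and decay: "\<And>k h. A \<le> k \<Longrightarrow> k < h \<Longrightarrow> (h - k) powr q * a h \<le> C * a k powr (1 + \<delta>)"
  defines "d \<equiv> (C * B powr \<delta> * 2 powr (q + q / \<delta>) + 1) powr (1 / q)"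
  shows "a (A + d) = 0"
proof -
  \<comment> \<open>Halving a level gap costs the factor \<open>x\<close>; the rate \<rho> is tuned
    so that \<rho>^\<delta> = x.\<close>
  define x :: real where "x = 2 powr - q"
  define \<rho> where "\<rho> = x powr (1 / \<delta>)"
  have x: "0 < x" "x < 1" using q by (simp_all add: x_def powr_minus powr_less_one inverse_less_1_iff)
  have \<rho>: "0 < \<rho>" "\<rho> < 1"
    using x \<delta> powr_less_mono2[of "1 / \<delta>" x 1] by (simp_all add: \<rho>_def)
  \<comment> \<open>The summand 1 keeps \<open>d\<close> positive even for
    \<open>C = 0\<close>.\<close>
  have pos: "0 < C * B powr \<delta> * 2 powr (q + q / \<delta>) + 1"
    using C by (intro add_nonneg_pos) auto
  then have d: "0 < d" by (simp add: d_def)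
  have "d powr q = C * B powr \<delta> * 2 powr (q + q / \<delta>) + 1"
    using q pos by (simp add: d_def powr_powr)
  moreover have "2 powr (q + q / \<delta>) * x * \<rho> = (1 :: real)"
    by (simp add: x_def \<rho>_def powr_powr flip: powr_add)
  ultimately have "d powr q * (x * \<rho>) = C * B powr \<delta> + x * \<rho>"
    by (simp add: algebra_simps)
  then have dq: "C * B powr \<delta> \<le> d powr q * (x * \<rho>)"
    using x \<rho> by simp
  have half: "(d / 2 ^ n) powr q = d powr q * x ^ n" for n
  proof -
    have "(2 ^ n) powr q * x ^ n = (1 :: real)"
      by (simp add: x_def powr_powr powr_realpow[symmetric] algebra_simps flip: powr_add)
    then show ?thesis using d by (simp add: powr_divide field_simps)
  qed
  have next_level: "C * (B * \<rho> ^ n) powr (1 + \<delta>) \<le> d powr q * x ^ Suc n * (B * \<rho> ^ Suc n)" for n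
  proof -
    have "(\<rho> ^ n) powr \<delta> = x ^ n"
      using \<rho> x \<delta> by (simp add: \<rho>_def powr_powr powr_realpow[symmetric] algebra_simps)
    then have "C * (B * \<rho> ^ n) powr (1 + \<delta>) = (C * B powr \<delta>) * (B * \<rho> ^ n * x ^ n)"
      using B \<rho> by (simp add: powr_add powr_mult)
    also have "\<dots> \<le> d powr q * (x * \<rho>) * (B * \<rho> ^ n * x ^ n)"
      using dq B \<rho> x by (intro mult_right_mono) auto
    finally show ?thesis by (simp add: algebra_simps)
  qed
  define k where "k n = A + d * (1 - 1 / 2 ^ n)" for n :: nat
  have kA: "A \<le> k n" for n
    using d by (simp add: k_def)
  have bound: "a (k n) \<le> B * \<rho> ^ n" for n
  proof (induction n)
    case 0
    then show ?case using a(2)[of A] by (simp add: k_def)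
  next
    case (Suc n)
    have diff: "k (Suc n) - k n = d / 2 ^ Suc n"
      by (simp add: k_def field_simps)
    then have "k n < k (Suc n)" using d by (smt (verit) divide_pos_pos zero_less_power)
    from decay[OF kA this] have "d powr q * x ^ Suc n * a (k (Suc n)) \<le> C * a (k n) powr (1 + \<delta>)"
      unfolding diff half by simp
    also have "\<dots> \<le> C * (B * \<rho> ^ n) powr (1 + \<delta>)"
      using Suc a(1)[OF kA] C \<delta> by (intro mult_left_mono powr_mono2) auto
    also note next_level
    finally show ?case
      using d x by (simp add: mult_le_cancel_left_pos del: power_Suc)
  qed
  \<comment> \<open>The decay is applied once more, from each \<open>k n\<close> straight to the
    limit level.\<close>
  have "a (A + d) \<le> x * B * \<rho> * \<rho> ^ n" for n
  proof -
    have diff: "A + d - k n = d / 2 ^ n"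
      by (simp add: k_def field_simps)
    then have "k n < A + d" using d by (smt (verit) divide_pos_pos zero_less_power)
    from decay[OF kA this] have "d powr q * x ^ n * a (A + d) \<le> C * a (k n) powr (1 + \<delta>)"
      unfolding diff half by simp
    also have "\<dots> \<le> C * (B * \<rho> ^ n) powr (1 + \<delta>)"
      using bound a(1)[OF kA] C \<delta> by (intro mult_left_mono powr_mono2) auto
    also note next_level
    also have "d powr q * x ^ Suc n * (B * \<rho> ^ Suc n) = d powr q * x ^ n * (x * B * \<rho> * \<rho> ^ n)"
      by (simp add: algebra_simps)
    finally show ?thesis
      using d x by (simp add: mult_le_cancel_left_pos)
  qed
  moreover have "(\<lambda>n. x * B * \<rho> * \<rho> ^ n) \<longlonglongrightarrow> x * B * \<rho> * 0"
    using \<rho> by (intro tendsto_mult tendsto_const LIMSEQ_realpow_zero) auto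
  ultimately have "a (A + d) \<le> 0"
    by (intro LIMSEQ_le_const[of _ 0]) auto
  then show ?thesis
    using a(1)[of "A + d"] d by simp
qed

text \<open>The real-variable part of the argument: \<open>i\<close> stands for a solution,
  \<open>a i k\<close> for the measure of {u > k} and \<open>G i k\<close> for its level mass. The
  constants do not depend on \<open>i\<close>, which makes the vanishing level common to all
  solutions.\<close>

locale level_decay =
  fixes S :: "'i set" and a G :: "'i \<Rightarrow> real \<Rightarrow> real" and D :: "real \<Rightarrow> real"
    and q \<sigma> m \<beta> A B C1 C2 C3 :: real
  assumes q: "0 < q" and \<sigma>: "0 < \<sigma>" and m: "0 < m" and \<beta>: "0 < \<beta>" and A: "1 \<le> A" and B: "0 < B"
    and subcritical: "0 < q - m + (m + \<beta>) * \<sigma>"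
    and C: "0 \<le> C1" "0 \<le> C2" "0 \<le> C3" "\<And>\<kappa>. m < \<kappa> \<Longrightarrow> 0 \<le> D \<kappa>"
    and a: "\<And>i k. i \<in> S \<Longrightarrow> A \<le> k \<Longrightarrow> 0 \<le> a i k" "\<And>i k. i \<in> S \<Longrightarrow> A \<le> k \<Longrightarrow> a i k \<le> B"
    and decay: "\<And>i k h. i \<in> S \<Longrightarrow> A \<le> k \<Longrightarrow> k < h \<Longrightarrow>
      (h - k) powr q * a i h \<le> C1 * a i k powr \<sigma> * G i k"
    and markov: "\<And>i k. i \<in> S \<Longrightarrow> A \<le> k \<Longrightarrow> G i k \<le> C2 * k powr - \<beta>"
    and layer: "\<And>i k \<kappa> K. i \<in> S \<Longrightarrow> A \<le> k \<Longrightarrow> m < \<kappa> \<Longrightarrow> 0 \<le> K \<Longrightarrow>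
      (\<And>t. k \<le> t \<Longrightarrow> a i t \<le> K * t powr - \<kappa>) \<Longrightarrow> G i k \<le> D \<kappa> * K * k powr (m - \<kappa>)"
    and split: "\<And>i k T. i \<in> S \<Longrightarrow> A \<le> k \<Longrightarrow> A \<le> T \<Longrightarrow> G i k \<le> C3 * (1 + T) powr m * a i k + G i T"
begin

definition tail :: "real \<Rightarrow> bool" where
  "tail \<kappa> \<longleftrightarrow> (\<exists>K\<ge>0. \<forall>i\<in>S. \<forall>k\<ge>A. a i k \<le> K * k powr - \<kappa>)"

text \<open>The decay from \<open>k / 2\<close> to \<open>k\<close> turns the rates \<kappa> of
  \<open>a\<close> and \<mu> of \<open>G\<close> into the rate \<kappa> \<sigma> + \<mu> + q for
  \<open>a\<close>.\<close>

lemma tail_step: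
  assumes "tail \<kappa>" "0 \<le> \<kappa>"
  shows "tail (\<kappa> + min q (q - m + (m + \<beta>) * \<sigma>))"
proof -
  define \<kappa>' where "\<kappa>' = \<kappa> + min q (q - m + (m + \<beta>) * \<sigma>)"
  \<comment> \<open>The better of the two rates for \<open>G\<close>: \<beta> from
    \<open>markov\<close>, or \<kappa> - m from \<open>layer\<close>.\<close>
  define \<mu> where "\<mu> = (if \<kappa> \<le> m + \<beta> then \<beta> else \<kappa> - m)"
  have \<kappa>': "0 \<le> \<kappa>'" using assms q subcritical by (simp add: \<kappa>'_def)
  obtain K where K: "0 \<le> K" "\<And>i k. i \<in> S \<Longrightarrow> A \<le> k \<Longrightarrow> a i k \<le> K * k powr - \<kappa>"
    using assms(1) unfolding tail_def by blast
  obtain K2 where K2: "0 \<le> K2" "\<And>i k. i \<in> S \<Longrightarrow> A \<le> k \<Longrightarrow> G i k \<le> K2 * k powr - \<mu>"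
  proof (cases "\<kappa> \<le> m + \<beta>")
    case True
    then show ?thesis using that[OF C(2)] markov by (simp add: \<mu>_def)
  next
    case False
    then have l: "m < \<kappa>" using \<beta> by simp
    have "G i k \<le> (D \<kappa> * K) * k powr - \<mu>" if "i \<in> S" "A \<le> k" for i k
      using layer[OF that l K(1)] K(2)[OF that(1)] that False by (simp add: \<mu>_def)
    then show ?thesis using that[of "D \<kappa> * K"] C(4)[OF l] K(1) by simp
  qed
  \<comment> \<open>For \<sigma> < 1 the gain is smallest at \<kappa> = m + \<beta>, where it equals
    the subcriticality margin; for \<sigma> \<ge> 1 and \<kappa> \<le> m + \<beta> it is at least
    \<open>q\<close>.\<close>
  have exponent: "\<kappa>' \<le> \<kappa> * \<sigma> + \<mu> + q"
  proof (cases "\<kappa> \<le> m + \<beta>")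
    case True
    have "\<kappa> + min q (q - m + (m + \<beta>) * \<sigma>) \<le> \<kappa> * \<sigma> + \<beta> + q"
    proof (cases "1 \<le> \<sigma>")
      case True
      then have "\<kappa> \<le> \<kappa> * \<sigma>" using assms(2) by (simp add: mult_le_cancel_left1)
      then show ?thesis using \<beta> by simp
    next
      case False
      then have "\<kappa> * (1 - \<sigma>) \<le> (m + \<beta>) * (1 - \<sigma>)"
        using True by (intro mult_right_mono) auto
      then show ?thesis by (simp add: algebra_simps min_le_iff_disj)
    qed
    then show ?thesis using True by (simp add: \<kappa>'_def \<mu>_def)
  next
    case False
    then have "(m + \<beta>) * \<sigma> \<le> \<kappa> * \<sigma>" using \<sigma> by simp
    then show ?thesis using False by (simp add: \<kappa>'_def \<mu>_def)
  qed
  \<comment> \<open>The second summand serves \<open>k < 2 * A\<close>, where \<open>k / 2\<close>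
    falls below \<open>A\<close>.\<close>
  define K' where "K' = C1 * K powr \<sigma> * K2 * 2 powr \<kappa>' + B * (2 * A) powr \<kappa>'"
  have "a i k \<le> K' * k powr - \<kappa>'" if i: "i \<in> S" and k: "A \<le> k" for i k
  proof (cases "2 * A \<le> k")
    case True
    define t where "t = k / 2"
    have t: "A \<le> t" "1 \<le> t" "k = 2 * t" using True A by (simp_all add: t_def)
    have "t powr q * a i k \<le> C1 * a i t powr \<sigma> * G i t"
      using decay[OF i t(1), of k] t by simp
    also have "\<dots> \<le> C1 * a i t powr \<sigma> * (K2 * t powr - \<mu>)"
      using K2(2)[OF i t(1)] C by (intro mult_left_mono) auto
    also have "\<dots> \<le> C1 * (K * t powr - \<kappa>) powr \<sigma> * (K2 * t powr - \<mu>)"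
      using K(2)[OF i t(1)] a(1)[OF i t(1)] C \<sigma> K2
      by (intro mult_right_mono mult_left_mono powr_mono2) auto
    also have "\<dots> = C1 * K powr \<sigma> * K2 * (t powr - (\<kappa> * \<sigma> + \<mu>))"
    proof -
      have "t powr - (\<kappa> * \<sigma> + \<mu>) = t powr - (\<kappa> * \<sigma>) * t powr - \<mu>"
        by (simp add: flip: powr_add)
      then show ?thesis
        using K t by (simp add: powr_mult powr_powr)
    qed
    finally have *: "t powr q * a i k \<le> C1 * K powr \<sigma> * K2 * t powr - (\<kappa> * \<sigma> + \<mu>)" .
    have "t powr - q * t powr q = 1"
      using t by (simp flip: powr_add)
    then have "a i k = t powr - q * (t powr q * a i k)"
      by (simp flip: mult.assoc)
    also have "\<dots> \<le> t powr - q * (C1 * K powr \<sigma> * K2 * t powr - (\<kappa> * \<sigma> + \<mu>))"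
      using * by (rule mult_left_mono) simp
    also have "\<dots> = C1 * K powr \<sigma> * K2 * (t powr - q * t powr - (\<kappa> * \<sigma> + \<mu>))"
      by (simp only: mult.left_commute)
    also have "t powr - q * t powr - (\<kappa> * \<sigma> + \<mu>) = t powr - (\<kappa> * \<sigma> + \<mu> + q)"
      by (simp flip: powr_add)
    also have "C1 * K powr \<sigma> * K2 * t powr - (\<kappa> * \<sigma> + \<mu> + q)
        \<le> C1 * K powr \<sigma> * K2 * t powr - \<kappa>'"
      using exponent t C K2 by (intro mult_left_mono powr_mono) auto
    also have "t powr - \<kappa>' = 2 powr \<kappa>' * k powr - \<kappa>'"
      using t by (simp add: powr_mult mult.assoc[symmetric] flip: powr_add)
    also have "C1 * K powr \<sigma> * K2 * (2 powr \<kappa>' * k powr - \<kappa>') \<le> K' * k powr - \<kappa>'"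
      using B by (simp add: K'_def mult.assoc[symmetric] distrib_right)
    finally show ?thesis .
  next
    case False
    have "1 \<le> (2 * A) powr \<kappa>' * k powr - \<kappa>'"
    proof -
      have "k powr \<kappa>' \<le> (2 * A) powr \<kappa>'"
        using False k A \<kappa>' by (intro powr_mono2) auto
      then show ?thesis using k A by (simp add: powr_minus field_simps)
    qed
    then have "B * 1 \<le> B * ((2 * A) powr \<kappa>' * k powr - \<kappa>')"
      using B by (intro mult_left_mono) auto
    also have "\<dots> \<le> K' * k powr - \<kappa>'"
      using C K2 by (simp add: K'_def mult.assoc[symmetric] distrib_right)
    finally show ?thesis using a(2)[OF i k] by simp
  qed
  moreover have "0 \<le> K'" using C K2 B by (simp add: K'_def)
  ultimately show ?thesis
    unfolding tail_def \<kappa>'_def[symmetric] by blast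
qed

text \<open>The bound \<open>B\<close> is a tail of exponent 0, and each step adds the same
  \<epsilon> > 0.\<close>

lemma tail_unbounded: "\<exists>\<kappa>\<ge>\<Lambda>. tail \<kappa>"
proof -
  define \<epsilon> where "\<epsilon> = min q (q - m + (m + \<beta>) * \<sigma>)"
  have \<epsilon>: "0 < \<epsilon>" using q subcritical by (simp add: \<epsilon>_def)
  have "tail (real n * \<epsilon>)" for n
  proof (induction n)
    case 0
    have "a i k \<le> B * k powr - 0" if "i \<in> S" "A \<le> k" for i k
      using a(2)[OF that] that A by simp
    then show ?case using B unfolding tail_def by (intro exI[of _ B]) auto
  next
    case (Suc n)
    have "tail (real n * \<epsilon> + \<epsilon>)"
      using tail_step[OF Suc, folded \<epsilon>_def] \<epsilon> by simp
    then show ?case by (simp add: algebra_simps)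
  qed
  moreover obtain n :: nat where "\<Lambda> / \<epsilon> \<le> real n" using real_arch_simple by blast
  then have "\<Lambda> \<le> real n * \<epsilon>" using \<epsilon> by (simp add: field_simps)
  ultimately show ?thesis by blast
qed

text \<open>A sufficiently fast tail gives \<open>G = O(a\<^sup>1\<^sup>-\<^sup>\<gamma>)\<close> with \<open>\<gamma> = \<sigma> / 2\<close>, on splitting at the level
  \<open>T = A (B / a)\<^sup>\<gamma>\<^sup>/\<^sup>m\<close>.\<close>

lemma eventually_vanishing: "\<exists>K. \<forall>i\<in>S. a i K = 0"
proof -
  define \<gamma> where "\<gamma> = \<sigma> / 2"
  have \<gamma>: "0 < \<gamma>" using \<sigma> by (simp add: \<gamma>_def)
  \<comment> \<open>Then (\<gamma> / m) (m - \<kappa>) \<le> -1, so the mass above \<open>T\<close>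
    is small enough in terms of \<open>a / B\<close>.\<close>
  obtain \<kappa> where \<kappa>: "m + m / \<gamma> \<le> \<kappa>" "tail \<kappa>"
    using tail_unbounded by blast
  have l: "m < \<kappa>" using \<kappa>(1) m \<gamma> by (smt (verit) divide_pos_pos)
  obtain K where K: "0 \<le> K" "\<And>i k. i \<in> S \<Longrightarrow> A \<le> k \<Longrightarrow> a i k \<le> K * k powr - \<kappa>"
    using \<kappa>(2) unfolding tail_def by blast
  define C4 where "C4 = C3 * (2 * A) powr m * B powr \<gamma> + D \<kappa> * K * A powr (m - \<kappa>) * B powr (\<gamma> - 1)"
  have C4: "0 \<le> C4" using C(3) C(4)[OF l] K by (simp add: C4_def)
  have G_le: "G i k \<le> C4 * a i k powr (1 - \<gamma>)" if i: "i \<in> S" and k: "A \<le> k" and pos: "a i k \<noteq> 0" for i k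
  proof -
    define v where "v = B / a i k"
    have ak: "0 < a i k" using a(1)[OF i k] pos by simp
    have v: "1 \<le> v" using a(2)[OF i k] ak by (simp add: v_def)
    define T where "T = A * v powr (\<gamma> / m)"
    have "1 \<le> v powr (\<gamma> / m)" using v \<gamma> m by (intro ge_one_powr_ge_zero) auto
    then have T: "A \<le> T" using A by (simp add: T_def mult_le_cancel_left1)
    have "(1 + T) powr m \<le> (2 * T) powr m"
      using T A m by (intro powr_mono2) auto
    also have "(2 * T) powr m = (2 * A) powr m * v powr \<gamma>"
      using A v m by (simp add: T_def powr_mult powr_powr)
    finally have "C3 * (1 + T) powr m * a i k \<le> C3 * ((2 * A) powr m * v powr \<gamma>) * a i k"
      using C ak by (intro mult_right_mono mult_left_mono) auto
    also have "\<dots> = C3 * (2 * A) powr m * B powr \<gamma> * a i k powr (1 - \<gamma>)"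
      using ak B by (simp add: v_def powr_divide powr_diff)
    finally have 1: "C3 * (1 + T) powr m * a i k \<le> \<dots>" .
    have "G i T \<le> D \<kappa> * K * T powr (m - \<kappa>)"
      using layer[OF i T l K(1)] K(2)[OF i] T by simp
    also have "T powr (m - \<kappa>) = A powr (m - \<kappa>) * v powr (\<gamma> / m * (m - \<kappa>))"
      using A v by (simp add: T_def powr_mult powr_powr)
    also have "D \<kappa> * K * (A powr (m - \<kappa>) * v powr (\<gamma> / m * (m - \<kappa>)))
        \<le> D \<kappa> * K * (A powr (m - \<kappa>) * v powr (\<gamma> - 1))"
    proof (intro mult_left_mono powr_mono)
      have "\<gamma> / m * (m / \<gamma>) \<le> \<gamma> / m * (\<kappa> - m)"
        using \<kappa>(1) \<gamma> m by (intro mult_left_mono) auto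
      then have "1 \<le> \<gamma> / m * (\<kappa> - m)" using \<gamma> m by simp
      moreover have "\<gamma> / m * (m - \<kappa>) = - (\<gamma> / m * (\<kappa> - m))"
        by (simp add: right_diff_distrib diff_divide_distrib)
      ultimately show "\<gamma> / m * (m - \<kappa>) \<le> \<gamma> - 1" using \<gamma> by linarith
    qed (use v C(4)[OF l] K in auto)
    also have "v powr (\<gamma> - 1) = B powr (\<gamma> - 1) * a i k powr (1 - \<gamma>)"
      using ak B by (simp add: v_def powr_divide powr_diff)
    finally have 2: "G i T \<le> D \<kappa> * K * A powr (m - \<kappa>) * B powr (\<gamma> - 1) * a i k powr (1 - \<gamma>)"
      by (simp add: mult.assoc)
    from split[OF i k T] 1 2 show ?thesis
      by (simp add: C4_def algebra_simps)
  qed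
  \<comment> \<open>As \<sigma> = 2 \<gamma>, the exponents \<sigma> and 1 - \<gamma> add up to 1 +
    \<gamma> > 1, as Stampacchia's lemma demands.\<close>
  have "(h - k) powr q * a i h \<le> C1 * C4 * a i k powr (1 + \<gamma>)" if i: "i \<in> S" and k: "A \<le> k" "k < h" for i k h
  proof (cases "a i k = 0")
    case True
    then show ?thesis using decay[OF i k] by simp
  next
    case False
    then have ak: "0 < a i k" using a(1)[OF i k(1)] by simp
    have "(h - k) powr q * a i h \<le> C1 * a i k powr \<sigma> * G i k" by (rule decay[OF i k])
    also have "\<dots> \<le> C1 * a i k powr \<sigma> * (C4 * a i k powr (1 - \<gamma>))"
      using G_le[OF i k(1) False] C by (intro mult_left_mono) auto
    also have "\<dots> = C1 * C4 * (a i k powr \<sigma> * a i k powr (1 - \<gamma>))" by simp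
    also have "a i k powr \<sigma> * a i k powr (1 - \<gamma>) = a i k powr (1 + \<gamma>)"
      by (simp add: \<gamma>_def add.commute flip: powr_add)
    finally show ?thesis .
  qed
  then have "a i (A + (C1 * C4 * B powr \<gamma> * 2 powr (q + q / \<gamma>) + 1) powr (1 / q)) = 0" if "i \<in> S" for i
    using that C C4 a by (intro stampacchia[OF q \<gamma> _ B]) auto
  then show ?thesis by blast
qed

end

section \<open>Uniform energy and supremum bounds over all nonnegative stable solutions\<close>

theorem theorem1p9:
  fixes s p m C0 :: real
    and \<Omega> :: "'a::euclidean_space set"
    and g :: "'a \<Rightarrow> real \<Rightarrow> real"
  assumes p: "p > 1" and s: "0 < s" "s < 1" and m: "m > p - 1"
    and \<Omega>: "bounded_C11_domain \<Omega>"
    and g_meas: "\<forall>w\<in>borel_measurable lebesgue.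
                   (\<lambda>x. g x (w x)) \<in> borel_measurable (lebesgue_on \<Omega>)"
    and g_diff: "AE x\<in>\<Omega> in lebesgue. \<forall>t. g x differentiable (at t)"
    and g_mono: "AE x\<in>\<Omega> in lebesgue. mono (g x)"
    and C0: "C0 > 0"
    and g_growth: "AE x\<in>\<Omega> in lebesgue. \<forall>t\<ge>0. 0 \<le> g x t \<and> g x t \<le> C0 * (1 + t) powr m"
    and g_liminf: "\<forall>m'<m. \<exists>A\<ge>0. AE x\<in>\<Omega> in lebesgue.
                     \<forall>t\<ge>A. deriv (g x) t * t \<ge> m' * g x t"
  shows "\<exists>C::real. \<forall>u.
           stable_solution s p \<Omega> g u \<and> (AE x in lebesgue. 0 \<le> u x) \<longrightarrow>
             gagliardo_seminorm s p u \<le> C \<and>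
             (real DIM('a) < G_crit s m p \<longrightarrow> Linf_norm \<Omega> u \<le> ereal C)"
proof -
  define S where "S = {u. stable_solution s p \<Omega> g u \<and> (AE x in lebesgue. 0 \<le> u x)}"
  have "\<Omega> \<in> lmeasurable"
    using \<Omega> by (simp add: bounded_C11_domain_def lmeasurable_open)
  then have S: "nonneg_stable_solution s p m C0 \<Omega> g u" if "u \<in> S" for u
    using that p s m C0 g_growth by (auto simp: S_def nonneg_stable_solution_def)
  \<comment> \<open>Both constants are chosen before \<open>u\<close> and \<open>k\<close>; the
    strict inequality leaves room for some \<open>m' < m\<close>, as the liminf condition
    requires.\<close>
  have reaction: "\<exists>A\<ge>1. \<exists>K\<ge>0. \<forall>u\<in>S. \<forall>k\<ge>A.
      (LINT x:\<Omega>|lebesgue. g x (u x) * trunc_power_energy \<alpha> k (u x)) \<le> K"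
    if \<alpha>: "1 \<le> \<alpha>" "(p - 1) * \<alpha>\<^sup>2 < m * (2 * \<alpha> - 1)" for \<alpha>
  proof -
    define c where "c = \<alpha>\<^sup>2 / (2 * \<alpha> - 1)"
    have c: "0 \<le> c" using \<alpha> by (simp add: c_def)
    have "(p - 1) * c < m" using \<alpha> by (simp add: c_def field_simps)
    then obtain m' where m': "(p - 1) * c < m'" "m' < m" using dense by blast
    obtain A0 where A0: "0 \<le> A0" "AE x\<in>\<Omega> in lebesgue. \<forall>t\<ge>A0. m' * g x t \<le> deriv (g x) t * t"
      using g_liminf m'(2) by blast
    define A where "A = max 1 A0"
    have A: "AE x\<in>\<Omega> in lebesgue. \<forall>t\<ge>A. m' * g x t \<le> deriv (g x) t * t"
      using A0(2) by eventually_elim (simp add: A_def)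
    define K where "K = m' / (m' - (p - 1) * c)
      * (C0 * (1 + A) powr m * (c * A powr (2 * \<alpha> - 1)) * measure lebesgue \<Omega>)"
    have "0 \<le> (p - 1) * c" using p c by simp
    then have "0 \<le> K" using m' c C0 by (simp add: K_def)
    moreover have "(LINT x:\<Omega>|lebesgue. g x (u x) * trunc_power_energy \<alpha> k (u x)) \<le> K"
      if "u \<in> S" "A \<le> k" for u k
    proof -
      interpret nonneg_stable_solution s p m C0 \<Omega> g u by (rule S[OF that(1)])
      have "(p - 1) * \<alpha>\<^sup>2 < m' * (2 * \<alpha> - 1)"
        using m'(1) \<alpha>(1) by (simp add: c_def field_simps)
      then show ?thesis
        unfolding K_def c_def using \<alpha>(1) that(2) by (intro reaction_energy_bound A) (auto simp: A_def)
    qed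
    ultimately show ?thesis by (intro exI[of _ A]) (auto simp: A_def)
  qed
  have "\<exists>C. \<forall>u\<in>S. gagliardo_seminorm s p u \<le> C"
  proof -
    obtain A K where "1 \<le> A"
      "\<And>u k. u \<in> S \<Longrightarrow> A \<le> k \<Longrightarrow> (LINT x:\<Omega>|lebesgue. g x (u x) * trunc_power_energy 1 k (u x)) \<le> K"
      using reaction[of 1] m by auto
    then have "gagliardo_seminorm s p u \<le> K powr (1 / p)" if "u \<in> S" for u
      using nonneg_stable_solution.seminorm_le[OF S[OF that], of A] that by simp
    then show ?thesis by blast
  qed
  then obtain C1 where C1: "\<And>u. u \<in> S \<Longrightarrow> gagliardo_seminorm s p u \<le> C1" by blast
  have "\<exists>C. \<forall>u\<in>S. Linf_norm \<Omega> u \<le> ereal C" if N: "real DIM('a) < G_crit s m p"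
  proof -
    define n where "n = real DIM('a)"
    define \<omega> where "\<omega> = unit_ball_vol n"
    define \<sigma> where "\<sigma> = s * p / n"
    have n: "0 < n" and sp: "0 < s * p" using s p by (simp_all add: n_def)
    \<comment> \<open>The bound on the dimension, multiplied by m - p + 1 > 0.\<close>
    have "n / (s * p) * (p - 1) * (m - (p - 1))
        < 2 * m - (p - 1) + m * (p - 1) + 2 * sqrt (m * (m - (p - 1)))"
    proof -
      define M where "M = m - p + 1"
      have M: "0 < M" using m by (simp add: M_def)
      define X where "X = 1 + m * p / M + 2 * sqrt (m / M)"
      have "n < s * p / (p - 1) * X"
        using N by (simp add: G_crit_def n_def X_def M_def)
      then have "n / (s * p) * (p - 1) < X"
        using sp p by (simp add: field_simps)
      then have "n / (s * p) * (p - 1) * M < X * M"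
        using M by (rule mult_strict_right_mono)
      also have "sqrt (m / M) * M = sqrt (m * M)"
        using M real_sqrt_mult[of "m / M" "M * M"] by simp
      then have "X * M = M + m * p + 2 * sqrt (m * M)"
        using M by (simp add: X_def distrib_right)
      finally show ?thesis by (simp add: M_def algebra_simps)
    qed
    then obtain \<alpha> where \<alpha>: "1 \<le> \<alpha>" "(p - 1) * \<alpha>\<^sup>2 < m * (2 * \<alpha> - 1)"
      and sub: "n / (s * p) * (m - (p - 1)) < m + 2 * \<alpha> - 1"
      using exists_stable_exponent[of "p - 1" m "n / (s * p)"] p m by auto
    obtain A K where A: "1 \<le> A" and K: "0 \<le> K"
      and AK: "\<And>u k. u \<in> S \<Longrightarrow> A \<le> k \<Longrightarrow>
        (LINT x:\<Omega>|lebesgue. g x (u x) * trunc_power_energy \<alpha> k (u x)) \<le> K"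
      using reaction[OF \<alpha>] by auto
    \<comment> \<open>The solutions themselves are the indices; adding 1 to the measure of \<Omega>
      makes the bound \<open>B\<close> evidently positive.\<close>
    interpret level_decay S "\<lambda>u k. measure lebesgue (nonneg_stable_solution.superlevel \<Omega> u k)"
      "nonneg_stable_solution.level_mass \<Omega> g" "\<lambda>\<kappa>. C0 * 4 powr m / (1 - 2 powr (m - \<kappa>))"
      "p - 1" \<sigma> m "2 * \<alpha> - 1" A "measure lebesgue \<Omega> + 1" "(2 / \<omega>) powr (1 + \<sigma>)"
      "K / (\<alpha>\<^sup>2 / (2 * \<alpha> - 1))" C0
    proof
      \<comment> \<open>The choice of \<alpha>, multiplied by \<sigma> = s p / N.\<close>
      show "0 < p - 1 - m + (m + (2 * \<alpha> - 1)) * \<sigma>"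
      proof -
        have "n / (s * p) * (m - (p - 1)) * \<sigma> < (m + 2 * \<alpha> - 1) * \<sigma>"
          using sub n sp by (intro mult_strict_right_mono) (simp_all add: \<sigma>_def)
        moreover have "n / (s * p) * (m - (p - 1)) * \<sigma> = m - (p - 1)"
          using n p s by (simp add: \<sigma>_def)
        ultimately show ?thesis by (simp add: algebra_simps)
      qed
      show "0 \<le> C0 * 4 powr m / (1 - 2 powr (m - \<kappa>))" if "m < \<kappa>" for \<kappa>
        using C0 that powr_less_one[of 2 "m - \<kappa>"] by simp
    next
      fix u k assume u: "u \<in> S" and k: "A \<le> k"
      interpret nonneg_stable_solution s p m C0 \<Omega> g u by (rule S[OF u])
      show "0 \<le> measure lebesgue (superlevel k)" by simp
      have "measure lebesgue (superlevel k) \<le> measure lebesgue \<Omega>"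
        using \<open>\<Omega> \<in> lmeasurable\<close> superlevel_sets
        by (intro measure_mono_fmeasurable) (auto simp: superlevel_def)
      then show "measure lebesgue (superlevel k) \<le> measure lebesgue \<Omega> + 1" by simp
      show "level_mass k \<le> K / (\<alpha>\<^sup>2 / (2 * \<alpha> - 1)) * k powr - (2 * \<alpha> - 1)"
        using A k by (intro level_mass_markov \<alpha>(1) AK u) auto
      show "(h - k) powr (p - 1) * measure lebesgue (superlevel h)
          \<le> (2 / \<omega>) powr (1 + \<sigma>) * measure lebesgue (superlevel k) powr \<sigma> * level_mass k" if "k < h" for h
        unfolding \<omega>_def \<sigma>_def n_def using A k that by (intro superlevel_decay) auto
      show "level_mass k \<le> C0 * 4 powr m / (1 - 2 powr (m - \<kappa>)) * K' * k powr (m - \<kappa>)"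
        if "m < \<kappa>" "0 \<le> K'" "\<And>t. k \<le> t \<Longrightarrow> measure lebesgue (superlevel t) \<le> K' * t powr - \<kappa>" for \<kappa> K'
        using A k that by (intro level_mass_le_tail) auto
      show "level_mass k \<le> C0 * (1 + T) powr m * measure lebesgue (superlevel k) + level_mass T"
        if "A \<le> T" for T
        using A k that by (intro level_mass_split) auto
    qed (use p m C0 n sp \<alpha> A K in \<open>auto simp: \<sigma>_def add_nonneg_pos\<close>)
    obtain C where "\<And>u. u \<in> S \<Longrightarrow> measure lebesgue (nonneg_stable_solution.superlevel \<Omega> u C) = 0"
      using eventually_vanishing by blast
    then show ?thesis
      using nonneg_stable_solution.Linf_norm_le[OF S] by blast
  qed
  then obtain C2 where C2: "\<And>u. u \<in> S \<Longrightarrow> real DIM('a) < G_crit s m p \<Longrightarrow> Linf_norm \<Omega> u \<le> ereal C2"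
    by blast
  have "gagliardo_seminorm s p u \<le> max C1 C2" if "u \<in> S" for u
    using C1[OF that] by simp
  moreover have "Linf_norm \<Omega> u \<le> ereal (max C1 C2)" if "u \<in> S" "real DIM('a) < G_crit s m p" for u
    using C2[OF that] by (rule order_trans) simp
  ultimately show ?thesis
    unfolding S_def by blast
qed

end
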